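(* Let $0<\alpha<10^{-5}$, $0\le\beta<10^{-5}$, and $n\ge\alpha^{-1}/2$. If $G$ is a graph of order $n$ with $e(G)>(1/4-\beta)n^{2}$, then one of the following conditions holds: (i) $c(G)\ge(1/2+\alpha)n$; (ii) there exists a set $M\subset V(G)$ with $|M|<840(\alpha+2\beta)n$ such that $G-M$ consists of two components $G_{1},G_{2}$ satisfying $$\left(\tfrac12-840(\alpha+2\beta)\right)n<|G_{1}|\le|G_{2}|<\left(\tfrac12+20(\alpha+2\beta)\right)n,$$ $$\delta(G_{1})\ge\tfrac{3n}{7},\qquad \delta(G_{2})\ge\tfrac{3n}{7}.$$
   Context: Graphs are finite, simple and undirected. $e(G)$ is the number of edges, $\delta(G)$ the minimum degree, and $|G|$ the order (number of vertices) of a graph $G$. $c(G)$ is the length of the longest cycle in $G$. $G-M$ is the graph obtained from $G$ by deleting the vertices in $M$; components are connected components. *)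

theory Defs
  imports Complex_Main
begin

type_synonym 'a ugraph = "'a set \<times> 'a set set"

abbreviation verts :: "'a ugraph \<Rightarrow> 'a set" where
  "verts G \<equiv> fst G"

abbreviation edges :: "'a ugraph \<Rightarrow> 'a set set" where
  "edges G \<equiv> snd G"

definition simple_graph :: "'a ugraph \<Rightarrow> bool" where
  "simple_graph G \<longleftrightarrow> finite (verts G) \<and> (\<forall>e\<in>edges G. e \<subseteq> verts G \<and> card e = 2)"

definition graph_order :: "'a ugraph \<Rightarrow> nat" where
  "graph_order G = card (verts G)"

definition num_edges :: "'a ugraph \<Rightarrow> nat" where
  "num_edges G = card (edges G)"

definition degree :: "'a ugraph \<Rightarrow> 'a \<Rightarrow> nat" where
  "degree G v = card {e \<in> edges G. v \<in> e}"

(* Meaningful for finite graphs with at least one vertex only. *)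
definition min_degree :: "'a ugraph \<Rightarrow> nat" where
  "min_degree G = Min (degree G ` verts G)"

(* A cycle is the list of its vertices in cyclic order; its length is the length of the list. *)
definition is_cycle :: "'a ugraph \<Rightarrow> 'a list \<Rightarrow> bool" where
  "is_cycle G vs \<longleftrightarrow>
     3 \<le> length vs \<and> distinct vs \<and> set vs \<subseteq> verts G \<and>
     (\<forall>i<length vs. {vs ! i, vs ! (Suc i mod length vs)} \<in> edges G)"

(* The value is 0 for a graph without cycles. *)
definition circumference :: "'a ugraph \<Rightarrow> nat" where
  "circumference G = Max (insert 0 (length ` {vs. is_cycle G vs}))"

definition induced_subgraph :: "'a ugraph \<Rightarrow> 'a set \<Rightarrow> 'a ugraph" where
  "induced_subgraph G S = (verts G \<inter> S, {e \<in> edges G. e \<subseteq> S})"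

definition delete_verts :: "'a ugraph \<Rightarrow> 'a set \<Rightarrow> 'a ugraph" where
  "delete_verts G M = induced_subgraph G (verts G - M)"

definition reachable :: "'a ugraph \<Rightarrow> 'a \<Rightarrow> 'a \<Rightarrow> bool" where
  "reachable G = (\<lambda>u v. {u, v} \<in> edges G)\<^sup>*\<^sup>*"

definition components :: "'a ugraph \<Rightarrow> 'a ugraph set" where
  "components G = (\<lambda>v. induced_subgraph G {w. reachable G v w}) ` verts G"

end

theory Submission
  imports Defs
begin

text \<open>Put \<open>C = (1/2 + \<alpha>) n\<close> and \<open>\<gamma> = \<alpha> + 2 \<beta>\<close>, and suppose that every cycle is shorter than \<open>C\<close>. The number
of edges is then within \<open>\<gamma> n\<^sup>2 / 2\<close> of the Erdos--Gallai bound \<open>C n / 2\<close>, and the proof follows where a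
proof of that bound may lose edges.

The graph is dismantled by two kinds of deletions: single vertices of degree at most \<open>C / 2\<close>, and,
when no such vertex is left, the interior of an end block. Lemma \<open>end_block\<close> provides the
latter: if the minimum degree exceeds half of every cycle length, then some cycle on fewer than
\<open>C\<close> vertices contains all neighbours of all its vertices but one. A deletion of either kind removes at
most \<open>C / 2\<close> edges per vertex, which proves the bound (\<open>deficit_nonneg\<close>).
In a nearly extremal graph almost no deletion may be wasteful. Single vertices alone cannot exhaust
the graph, since the last \<open>C / 2\<close> of them have too few neighbours left; and an end block is wasteful
unless it is nearly complete and has nearly \<open>C\<close> vertices (\<open>dense_block\<close>).

So after peeling low-degree vertices there is a block that is nearly a clique on about \<open>n / 2\<close>
vertices. If what remains beyond it is of order more than \<open>4 \<gamma> n\<close>, it contains a second such block. The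
two blocks cover almost everything, and removing the other vertices together with the few vertices of low
degree yields the two components (\<open>two_sides_of_two_blocks\<close>). If hardly anything remains, then about
\<open>n / 2\<close> vertices were peeled beforehand, each sending about \<open>n / 4\<close> edges to what came after it.
The ones peeled last therefore have many neighbours in the near-clique, and enough of them can be
absorbed into a cycle through the near-clique to reach length \<open>C\<close>; this uses the
Bondy--Chvatal closure (\<open>many_vertices_outside_block\<close>).\<close>

section \<open>Paths and rotations\<close>

definition nbrs :: "'a set set \<Rightarrow> 'a set \<Rightarrow> 'a \<Rightarrow> 'a set" where
  "nbrs E S v = {u \<in> S. {u, v} \<in> E}"

definition inside :: "'a set set \<Rightarrow> 'a set \<Rightarrow> 'a set set" where
  "inside E S = {e \<in> E. e \<subseteq> S}"

definition is_path :: "'a set set \<Rightarrow> 'a list \<Rightarrow> bool" where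
  "is_path E q \<longleftrightarrow> distinct q \<and> successively (\<lambda>u v. {u, v} \<in> E) q"

text \<open>A cycle, cut open at one of its edges; paths are lists so that rotations can be written as
rearrangements of list segments.\<close>

definition closes_up :: "'a set set \<Rightarrow> 'a list \<Rightarrow> bool" where
  "closes_up E q \<longleftrightarrow> is_path E q \<and> 3 \<le> length q \<and> {hd q, last q} \<in> E"

lemma is_path_append:
  "is_path E (xs @ ys) \<longleftrightarrow> is_path E xs \<and> is_path E ys \<and> set xs \<inter> set ys = {} \<and>
     (xs = [] \<or> ys = [] \<or> {last xs, hd ys} \<in> E)"
  unfolding is_path_def successively_append_iff by auto

lemma is_path_rev [simp]: "is_path E (rev xs) \<longleftrightarrow> is_path E xs"
  unfolding is_path_def successively_rev by (simp add: insert_commute)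

lemma is_path_Cons:
  "is_path E (x # ys) \<longleftrightarrow> is_path E ys \<and> x \<notin> set ys \<and> (ys = [] \<or> {x, hd ys} \<in> E)"
  using is_path_append[of E "[x]" ys] by (auto simp: is_path_def)

text \<open>The next three lemmas are rotations of a path \<open>q\<close>: each rearranges \<open>q\<close> into a path
on the same vertices, with the same last vertex, that starts at \<open>q ! i\<close>. Here the new path runs from \<open>q ! i\<close> back to the head of \<open>q\<close> and
jumps from there to the successor of \<open>q ! i\<close>.\<close>

lemma path_restart_descending:
  assumes q: "is_path E q" and i: "Suc i < length q"
    and adj: "{hd q, q ! Suc i} \<in> E"
  shows "\<exists>q'. is_path E q' \<and> set q' = set q \<and> last q' = last q \<and> hd q' = q ! i \<and> q' \<noteq> []"
proof -
  define A where "A = take (Suc i) q"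
  define B where "B = drop (Suc i) q"
  have qAB: "q = A @ B" by (simp add: A_def B_def)
  have ne: "A \<noteq> []" "B \<noteq> []" using i by (auto simp: A_def B_def)
  have hA: "hd A = hd q" and lB: "last B = last q"
    using ne by (simp_all add: qAB)
  have lA: "last A = q ! i" and hB: "hd B = q ! Suc i"
    using i by (simp_all add: A_def B_def take_Suc_conv_app_nth hd_drop_conv_nth)
  have "{hd A, hd B} \<in> E" using adj by (simp only: hA hB)
  hence "is_path E (rev A @ B)"
    using q ne unfolding qAB is_path_append by (simp add: last_rev)
  moreover have "set (rev A @ B) = set q" "last (rev A @ B) = last q" "hd (rev A @ B) = q ! i"
    using ne lA lB by (auto simp: qAB hd_rev hd_append)
  ultimately show ?thesis using ne by blast
qed

text \<open>The new path runs from \<open>q ! i\<close> back to \<open>q ! Suc l\<close>, jumps to the head of \<open>q\<close>, runs forward to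
\<open>q ! l\<close>, and jumps to \<open>q ! Suc i\<close>.\<close>

lemma path_restart_crossing_before:
  assumes q: "is_path E q" and i: "Suc i < length q" and l: "l < i"
    and adj: "{hd q, q ! Suc l} \<in> E" "{q ! l, q ! Suc i} \<in> E"
  shows "\<exists>q'. is_path E q' \<and> set q' = set q \<and> last q' = last q \<and> hd q' = q ! i \<and> q' \<noteq> []"
proof -
  define A where "A = take (Suc l) q"
  define B where "B = take (i - l) (drop (Suc l) q)"
  define D where "D = drop (Suc i) q"
  have "drop (Suc l) q = B @ D"
    using l by (simp add: B_def D_def add.commute flip: drop_drop)
      (metis Suc_diff_le append_take_drop_id diff_Suc_Suc drop_drop le_add_diff_inverse2 less_imp_le_nat add_Suc_right)
  hence qABD: "q = A @ B @ D" by (metis A_def append_take_drop_id)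
  have ne: "A \<noteq> []" "B \<noteq> []" "D \<noteq> []" using i l by (auto simp: A_def B_def D_def)
  have "hd A = hd q" using ne by (simp add: qABD)
  moreover have "last A = q ! l" using i l by (simp add: A_def take_Suc_conv_app_nth)
  moreover have "hd B = q ! Suc l" using i l by (simp add: B_def hd_drop_conv_nth)
  moreover have "last B = q ! i" using i l ne by (auto simp: B_def last_conv_nth min_def)
  moreover have "hd D = q ! Suc i" using i by (simp add: D_def hd_drop_conv_nth)
  moreover have "last D = last q" using ne by (simp add: qABD)
  ultimately have e: "{hd A, hd B} \<in> E" "{last A, hd D} \<in> E" "last B = q ! i" "last D = last q"
    using adj by auto
  have "is_path E (rev B @ A @ D)"
    using q e ne unfolding qABD is_path_append
    by (auto simp: last_rev hd_append insert_commute)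
  moreover have "set (rev B @ A @ D) = set q" "last (rev B @ A @ D) = last q" "hd (rev B @ A @ D) = q ! i"
    using ne e by (auto simp: qABD hd_rev hd_append)
  ultimately show ?thesis using ne by blast
qed

text \<open>The new path runs from \<open>q ! i\<close> back to the head of \<open>q\<close>, jumps to \<open>q ! j\<close>, runs back to
\<open>q ! Suc i\<close>, and jumps to \<open>q ! Suc j\<close>.\<close>

lemma path_restart_crossing_after:
  assumes q: "is_path E q" and i: "i < j" and j: "Suc j < length q"
    and adj: "{hd q, q ! j} \<in> E" "{q ! Suc i, q ! Suc j} \<in> E"
  shows "\<exists>q'. is_path E q' \<and> set q' = set q \<and> last q' = last q \<and> hd q' = q ! i \<and> q' \<noteq> []"
proof -
  define A where "A = take (Suc i) q"
  define B where "B = take (j - i) (drop (Suc i) q)"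
  define D where "D = drop (Suc j) q"
  have "drop (Suc i) q = B @ D"
    using i by (simp add: B_def D_def)
      (metis Suc_diff_le append_take_drop_id diff_Suc_Suc drop_drop le_add_diff_inverse2 less_imp_le_nat add_Suc_right)
  hence qABD: "q = A @ B @ D" by (metis A_def append_take_drop_id)
  have ne: "A \<noteq> []" "B \<noteq> []" "D \<noteq> []" using i j by (auto simp: A_def B_def D_def)
  have "hd A = hd q" using ne by (simp add: qABD)
  moreover have "last A = q ! i" using i j by (simp add: A_def take_Suc_conv_app_nth)
  moreover have "hd B = q ! Suc i" using i j by (simp add: B_def hd_drop_conv_nth)
  moreover have "last B = q ! j" using i j ne by (auto simp: B_def last_conv_nth min_def)
  moreover have "hd D = q ! Suc j" using j by (simp add: D_def hd_drop_conv_nth)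
  moreover have "last D = last q" using ne by (simp add: qABD)
  ultimately have e: "{hd A, last B} \<in> E" "{hd B, hd D} \<in> E" "last A = q ! i" "last D = last q"
    using adj by auto
  have "is_path E (rev A @ rev B @ D)"
    using q e ne unfolding qABD is_path_append
    by (auto simp: last_rev hd_rev hd_append insert_commute)
  moreover have "set (rev A @ rev B @ D) = set q" "last (rev A @ rev B @ D) = last q"
    "hd (rev A @ rev B @ D) = q ! i"
    using ne e by (auto simp: qABD hd_rev hd_append)
  ultimately show ?thesis using ne by blast
qed

lemma card_nbrs_eq_card_indices:
  assumes "distinct q" "nbrs E V v \<subseteq> set q" "set q \<subseteq> V"
  shows "card (nbrs E V v) = card {k. k < length q \<and> {q ! k, v} \<in> E}"
proof -
  have "nbrs E V v = (!) q ` {k. k < length q \<and> {q ! k, v} \<in> E}"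
    using assms(2,3) by (fastforce simp: nbrs_def in_set_conv_nth)
  thus ?thesis using assms(1)
    by (simp add: card_image inj_on_def nth_eq_iff_index_eq)
qed

text \<open>The head of \<open>q\<close> and the vertex \<open>q ! Suc i\<close> each have at least \<open>d\<close> neighbours on \<open>q\<close>, which has
fewer than \<open>2 * d\<close> vertices. By the pigeonhole principle their neighbours interleave, and each way of
interleaving is one of the three rotations. The consequence is that being the start of such a
rearranged path is inherited from a vertex to its predecessor.\<close>

lemma path_restart_previous:
  assumes q: "is_path E q" and V: "set q \<subseteq> V" and E: "\<forall>e\<in>E. card e = 2"
    and i: "Suc i < length q" and len: "length q < 2 * d"
    and h: "nbrs E V (hd q) \<subseteq> set q" "d \<le> card (nbrs E V (hd q))"
    and s: "nbrs E V (q ! Suc i) \<subseteq> set q" "d \<le> card (nbrs E V (q ! Suc i))"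
  shows "\<exists>q'. is_path E q' \<and> set q' = set q \<and> last q' = last q \<and> hd q' = q ! i \<and> q' \<noteq> []"
proof -
  have dist: "distinct q" using q by (simp add: is_path_def)
  have loop: "{v, v} \<notin> E" for v using E by fastforce
  define a where "a = length q"
  have q0: "hd q = q ! 0" using i by (cases q) auto
  define A where "A = {k. k < a \<and> {q ! k, hd q} \<in> E}"
  define I where "I = {k. k < a \<and> {q ! k, q ! Suc i} \<in> E}"
  \<comment> \<open>A position \<open>k\<close> of a neighbour of \<open>q ! Suc i\<close> is charged to the position \<open>f k\<close> where a neighbour of the head completes a rotation.\<close>
  \<comment> \<open>Only \<open>k = i\<close> and \<open>k = Suc (Suc i)\<close> share a value, and \<open>k = i\<close> is always a neighbour; leaving it out makes \<open>f\<close> injective.\<close>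
  define f where "f k = (if k \<le> i then Suc k else k - 1)" for k
  have finI: "finite I" by (simp add: I_def)
  have cA: "d \<le> card A"
    using card_nbrs_eq_card_indices[OF dist h(1) V] h(2) by (simp add: A_def a_def)
  have cI: "d \<le> card I"
    using card_nbrs_eq_card_indices[OF dist s(1) V] s(2) by (simp add: I_def a_def)
  have Asub: "A \<subseteq> {1..<a}"
    using loop[of "q ! 0"] q0 by (auto simp: A_def Suc_le_eq intro!: gr0I)
  have Suci: "Suc i \<notin> I" using loop by (auto simp: I_def)
  have inj: "inj_on f (I - {i})"
  proof (rule inj_onI)
    fix x y assume "x \<in> I - {i}" "y \<in> I - {i}" and f: "f x = f y"
    hence "x \<noteq> i" "y \<noteq> i" "x \<noteq> Suc i" "y \<noteq> Suc i" using Suci by auto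
    thus "x = y" using f by (cases "x \<le> i"; cases "y \<le> i") (auto simp: f_def)
  qed
  have cf: "d - 1 \<le> card (f ` (I - {i}))"
    using cI finI by (auto simp: card_image[OF inj] card_Diff_singleton_if)
  have fsub: "f ` (I - {i}) \<subseteq> {1..<a}"
  proof -
    have "1 \<le> f k \<and> f k < a" if "k \<in> I - {i}" for k
      using that i Suci by (cases "k = Suc i") (auto simp: f_def I_def a_def)
    thus ?thesis unfolding image_subset_iff atLeastLessThan_iff by blast
  qed
  have "A \<inter> f ` (I - {i}) \<noteq> {}"
  proof
    assume "A \<inter> f ` (I - {i}) = {}"
    hence "card A + card (f ` (I - {i})) = card (A \<union> f ` (I - {i}))"
      by (intro card_Un_disjoint[symmetric]) (auto simp: A_def finI)
    also have "\<dots> \<le> card {1..<a}" using Asub fsub by (intro card_mono) auto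
    finally show False using cA cf len i by (simp add: a_def)
  qed
  then obtain k where k: "k \<in> I" "k \<noteq> i" "f k \<in> A" by blast
  show ?thesis
  proof (cases "k \<le> i")
    case True
    hence "k < i" using k by simp
    moreover have "{hd q, q ! Suc k} \<in> E" using k True by (simp add: f_def A_def insert_commute)
    moreover have "{q ! k, q ! Suc i} \<in> E" using k by (simp add: I_def)
    ultimately show ?thesis using path_restart_crossing_before[OF q i] by blast
  next
    case False
    then obtain j where j: "k = Suc j" "i < j"
      using k Suci by (metis Suc_lessI not_le_imp_less not_less_eq less_imp_Suc_add add_Suc_right less_add_Suc1)
    have "{hd q, q ! j} \<in> E" "{q ! Suc i, q ! Suc j} \<in> E" "Suc j < length q"
      using k j False by (simp_all add: f_def A_def I_def insert_commute a_def)
    thus ?thesis using path_restart_crossing_after[OF q j(2)] by blast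
  qed
qed

section \<open>End blocks of graphs with large minimum degree\<close>

text \<open>This is the engine of the whole proof: a graph whose minimum degree exceeds half of its longest cycle
has an end block, or a component, spanned by a cycle. Take a longest path, and among all longest paths one whose
initial segment \<open>q\<close> with adjacent ends is as long as possible; \<open>q\<close> is a cycle. If
\<open>q\<close> can be rearranged, keeping its last vertex \<open>x\<close>, so as to start at \<open>w\<close>, then all neighbours of
\<open>w\<close> lie on \<open>q\<close>: a neighbour off the path would extend it, and a neighbour further down the path would
lengthen the segment. The vertex before \<open>x\<close> is such a \<open>w\<close>, and the property passes from each vertex
to its predecessor. So every vertex of \<open>q\<close> except \<open>x\<close> has all its neighbours on \<open>q\<close>.\<close>

lemma end_block:
  assumes fin: "finite V" and ne: "V \<noteq> {}" and E: "\<forall>e\<in>E. card e = 2" and d: "2 \<le> d"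
    and deg: "\<And>v. v \<in> V \<Longrightarrow> d \<le> card (nbrs E V v)"
    and short: "\<And>q. closes_up E q \<Longrightarrow> set q \<subseteq> V \<Longrightarrow> length q < 2 * d"
  obtains W x q where "closes_up E q" "set q = insert x W" "insert x W \<subseteq> V" "x \<notin> W"
    "\<And>w. w \<in> W \<Longrightarrow> nbrs E V w \<subseteq> insert x W"
proof -
  have loop: "{v, v} \<notin> E" for v using E by fastforce
  define P where "P = (\<lambda>(q, r). is_path E (q @ r) \<and> set (q @ r) \<subseteq> V \<and> q \<noteq> [] \<and> {hd q, last q} \<in> E)"
  \<comment> \<open>Maximising \<open>f\<close> maximises the length of the whole path first and the length of \<open>q\<close> second.\<close>
  define f where "f = (\<lambda>(q :: 'a list, r :: 'a list). length (q @ r) * Suc (card V) + length q)"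
  obtain v where v: "v \<in> V" using ne by blast
  have "nbrs E V v \<noteq> {}" using deg[OF v] d by (metis card.empty not_numeral_le_zero order_trans)
  then obtain u where u: "u \<in> V" "{u, v} \<in> E" by (auto simp: nbrs_def)
  hence P0: "P ([v, u], [])" using v loop by (auto simp: P_def is_path_def insert_commute)
  have len: "length p \<le> card V" if "is_path E p" "set p \<subseteq> V" for p
    using that fin by (metis card_mono distinct_card is_path_def)
  have bd: "\<forall>y. P y \<longrightarrow> f y < Suc (card V) * Suc (card V)"
  proof (intro allI impI)
    fix y assume "P y"
    moreover obtain q r where y: "y = (q, r)" by fastforce
    ultimately have l: "length (q @ r) \<le> card V" by (intro len) (auto simp: P_def)
    hence "length (q @ r) * Suc (card V) \<le> card V * Suc (card V)" by (intro mult_right_mono) auto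
    moreover have "length q \<le> card V" using l by simp
    ultimately show "f y < Suc (card V) * Suc (card V)" by (simp add: f_def y)
  qed
  obtain y where "P y" and ymax: "\<And>y'. P y' \<Longrightarrow> f y' \<le> f y"
    using Lattices_Big.ex_has_greatest_nat[OF P0 bd] by blast
  obtain q r where y: "y = (q, r)" by fastforce
  have qr: "is_path E (q @ r)" "set (q @ r) \<subseteq> V" "q \<noteq> []" "{hd q, last q} \<in> E"
    using \<open>P y\<close> by (auto simp: P_def y)
  have max1: False if "P (q', r')" "length (q' @ r') > length (q @ r)" for q' r'
  proof -
    have "length q \<le> card V" using len[OF qr(1,2)] by simp
    hence "length (q @ r) * Suc (card V) + length q < Suc (length (q @ r)) * Suc (card V)" by simp
    also have "\<dots> \<le> length (q' @ r') * Suc (card V)" using that(2) by (intro mult_right_mono) auto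
    finally show False using ymax[OF that(1)] by (simp add: f_def y)
  qed
  have max2: False if "P (q', r')" "length (q' @ r') = length (q @ r)" "length q' > length q" for q' r'
    using ymax[OF that(1)] that(2,3) by (simp add: f_def y)
  have confined: "nbrs E V (hd q') \<subseteq> set q"
    if q': "is_path E q'" "set q' = set q" "last q' = last q" "q' \<noteq> []" for q'
  proof
    fix u assume u: "u \<in> nbrs E V (hd q')"
    hence uV: "u \<in> V" and ue: "{u, hd q'} \<in> E" by (auto simp: nbrs_def)
    have lenq: "length q' = length q"
      using q' qr(1) by (metis distinct_card distinct_append is_path_def)
    have p': "is_path E (q' @ r)" using q' qr(1,3) by (simp add: is_path_append)
    show "u \<in> set q"
    proof (rule ccontr)
      assume nu: "u \<notin> set q"
      show False
      proof (cases "u \<in> set r")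
        case True
        then obtain r1 r2 where r: "r = r1 @ u # r2" by (meson split_list)
        have "P (q' @ r1 @ [u], r2)"
          using p' q' qr(2) uV ue r by (auto simp: P_def insert_commute)
        thus False using max2[of "q' @ r1 @ [u]" r2] lenq r by simp
      next
        case False
        have "is_path E (u # q' @ r)"
          using p' nu q' ue False by (simp add: is_path_Cons)
        moreover have "q' = hd q' # tl q'" using q' by simp
        ultimately have "is_path E ([u, hd q'] @ tl q' @ r)" by (metis append_Cons append_Nil)
        moreover have "set ([u, hd q'] @ tl q' @ r) \<subseteq> V"
          using qr(2) q' uV by (cases q') auto
        ultimately have "P ([u, hd q'], tl q' @ r)" using ue by (simp add: P_def)
        moreover have "length ([u, hd q'] @ tl q' @ r) > length (q @ r)" using lenq q'(4) by simp
        ultimately show False by (rule max1)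
      qed
    qed
  qed
  have pq: "is_path E q" using qr(1) by (simp add: is_path_append)
  have qV: "set q \<subseteq> V" using qr(2) by simp
  have conf0: "nbrs E V (hd q) \<subseteq> set q" using confined pq qr(3) by blast
  have "nbrs E V (hd q) \<subseteq> set q - {hd q}" using conf0 loop by (auto simp: nbrs_def)
  hence "card (nbrs E V (hd q)) \<le> card (set q - {hd q})" by (intro card_mono) auto
  moreover have "d \<le> card (nbrs E V (hd q))" using deg qV qr(3) by (meson hd_in_set subsetD)
  ultimately have "3 \<le> length q"
    using pq qr(3) d by (simp add: is_path_def distinct_card)
  hence cl: "closes_up E q" using pq qr(4) by (simp add: closes_up_def)
  hence short': "length q < 2 * d" using short qV by blast
  have R: "\<exists>q'. is_path E q' \<and> set q' = set q \<and> last q' = last q \<and> hd q' = q ! i \<and> q' \<noteq> []"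
    if "i \<le> length q - 2" for i
    using that
  proof (induction rule: inc_induct)
    case base
    have "{hd q, q ! Suc (length q - 2)} \<in> E"
      using qr(3,4) \<open>3 \<le> length q\<close> by (simp add: last_conv_nth Suc_diff_le numeral_2_eq_2 Suc_diff_Suc)
    thus ?case using path_restart_descending[OF pq, of "length q - 2"] \<open>3 \<le> length q\<close> by simp
  next
    case (step i)
    then obtain q' where q': "is_path E q'" "set q' = set q" "last q' = last q" "hd q' = q ! Suc i" "q' \<noteq> []"
      by blast
    have "nbrs E V (q ! Suc i) \<subseteq> set q" using confined[OF q'(1,2,3,5)] q'(4) by simp
    moreover have "q ! Suc i \<in> V" using q'(2,4,5) qV by (metis hd_in_set subsetD)
    moreover have "hd q \<in> V" using qr(3) qV by (meson hd_in_set subsetD)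
    ultimately show ?case
      using path_restart_previous[OF pq qV E _ short' conf0] deg step \<open>3 \<le> length q\<close> by simp
  qed
  have dq: "distinct q" using pq by (simp add: is_path_def)
  have sp: "q = butlast q @ [last q]" using qr(3) by simp
  have sq: "set q = insert (last q) (set (butlast q))"
    by (subst sp) (simp only: set_append, simp)
  show ?thesis
  proof (rule that[OF cl sq])
    show "insert (last q) (set (butlast q)) \<subseteq> V" using qV sq by simp
    show "last q \<notin> set (butlast q)" using dq sp by (metis distinct_append disjoint_iff list.set_intros(1))
    fix w assume "w \<in> set (butlast q)"
    then obtain i where i: "i < length q - 1" "w = q ! i"
      by (metis in_set_conv_nth length_butlast nth_butlast)
    then obtain q' where "is_path E q'" "set q' = set q" "last q' = last q" "hd q' = w" "q' \<noteq> []"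
      using R[of i] by fastforce
    thus "nbrs E V w \<subseteq> insert (last q) (set (butlast q))" using confined sq by blast
  qed
qed

section \<open>Counting edges inside a vertex set\<close>

lemma finite_inside: "finite S \<Longrightarrow> finite (inside E S)"
  by (rule finite_subset[of _ "Pow S"]) (auto simp: inside_def)

lemma finite_nbrs: "finite S \<Longrightarrow> finite (nbrs E S v)"
  by (simp add: nbrs_def)

lemma nbrs_mono: "S \<subseteq> T \<Longrightarrow> nbrs E S v \<subseteq> nbrs E T v"
  by (auto simp: nbrs_def)

lemma card_inside_insert:
  assumes E: "\<forall>e\<in>E. card e = 2" and S: "finite S" "v \<notin> S"
  shows "card (inside E (insert v S)) = card (inside E S) + card (nbrs E S v)"
proof -
  have "e \<in> inside E S \<union> (\<lambda>u. {u, v}) ` nbrs E S v" if "e \<in> inside E (insert v S)" for e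
  proof -
    have "card e = 2" "e \<in> E" "e \<subseteq> insert v S" using that E by (auto simp: inside_def)
    then obtain x y where "e = {x, y}" "x \<noteq> y" by (meson card_2_iff)
    with \<open>e \<in> E\<close> \<open>e \<subseteq> insert v S\<close> show ?thesis
      by (auto simp: inside_def nbrs_def insert_commute)
  qed
  hence eq: "inside E (insert v S) = inside E S \<union> (\<lambda>u. {u, v}) ` nbrs E S v"
    by (auto simp: inside_def nbrs_def)
  have "inj_on (\<lambda>u. {u, v}) (nbrs E S v)"
    by (auto simp: inj_on_def doubleton_eq_iff)
  moreover have "inside E S \<inter> (\<lambda>u. {u, v}) ` nbrs E S v = {}"
    using S(2) by (auto simp: inside_def)
  ultimately show ?thesis
    by (simp add: eq card_Un_disjoint finite_inside finite_nbrs S card_image)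
qed

lemma sum_card_nbrs:
  assumes E: "\<forall>e\<in>E. card e = 2" and S: "finite S"
  shows "(\<Sum>v\<in>S. card (nbrs E S v)) = 2 * card (inside E S)"
  using S
proof induction
  case empty
  have "inside E {} = {}" using E by (auto simp: inside_def)
  thus ?case by simp
next
  case (insert v S)
  have vv: "{v, v} \<notin> E" using E by fastforce
  have one: "card (nbrs E (insert v S) u) = card (nbrs E S u) + (if {u, v} \<in> E then 1 else 0)" for u
  proof -
    have "nbrs E (insert v S) u = (if {u, v} \<in> E then insert v (nbrs E S u) else nbrs E S u)"
      by (auto simp: nbrs_def insert_commute)
    moreover have "v \<notin> nbrs E S u" using insert by (simp add: nbrs_def)
    ultimately show ?thesis using insert by (simp add: finite_nbrs)
  qed
  have "(\<Sum>u\<in>S. card (nbrs E (insert v S) u)) = 2 * card (inside E S) + (\<Sum>u\<in>S. if {u, v} \<in> E then 1 else 0)"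
    by (simp add: one sum.distrib insert.IH)
  also have "(\<Sum>u\<in>S. if {u, v} \<in> E then 1 else 0) = card (nbrs E S v)"
    using insert(1) by (simp add: nbrs_def sum.If_cases Int_def)
  finally show ?case
    using insert one[of v] vv by (simp add: card_inside_insert[OF E])
qed

lemma card_inside_le:
  assumes E: "\<forall>e\<in>E. card e = 2" and S: "finite S"
  shows "2 * card (inside E S) \<le> card S * (card S - 1)"
proof -
  have loop: "{v, v} \<notin> E" for v using E by fastforce
  have "card (nbrs E S v) \<le> card S - 1" if "v \<in> S" for v
  proof -
    have "nbrs E S v \<subseteq> S - {v}" using loop by (auto simp: nbrs_def)
    hence "card (nbrs E S v) \<le> card (S - {v})" using S by (intro card_mono) auto
    thus ?thesis using that S by simp
  qed
  hence "(\<Sum>v\<in>S. card (nbrs E S v)) \<le> card S * (card S - 1)"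
    using sum_bounded_above[of S "\<lambda>v. card (nbrs E S v)" "card S - 1"] by simp
  thus ?thesis by (simp add: sum_card_nbrs[OF E S])
qed

text \<open>Adding the vertices of \<open>P\<close> one after the other: each brings at most its degree in the final set.\<close>

lemma card_inside_Un_le:
  assumes E: "\<forall>e\<in>E. card e = 2" and fin: "finite V" "finite P" and disj: "P \<inter> V = {}"
  shows "card (inside E (V \<union> P)) \<le> card (inside E V) + (\<Sum>y\<in>P. card (nbrs E (V \<union> P) y))"
  using fin(2) disj
proof induction
  case (insert y P)
  have mono: "card (nbrs E (V \<union> P) z) \<le> card (nbrs E (V \<union> insert y P) z)" for z
    using fin(1) insert(1) by (intro card_mono finite_nbrs nbrs_mono) auto
  hence "(\<Sum>z\<in>P. card (nbrs E (V \<union> P) z)) \<le> (\<Sum>z\<in>P. card (nbrs E (V \<union> insert y P) z))"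
    and *: "card (nbrs E (V \<union> P) y) \<le> card (nbrs E (V \<union> insert y P) y)"
    using mono by (auto intro: sum_mono simp del: Un_insert_right)
  moreover have "card (inside E (V \<union> insert y P)) = card (inside E (V \<union> P)) + card (nbrs E (V \<union> P) y)"
    using card_inside_insert[OF E, of "V \<union> P" y] insert fin(1) by simp
  ultimately show ?case using insert by simp
qed simp

section \<open>Hamiltonian cycles by the Bondy--Chvatal closure\<close>

definition hamiltonian :: "'a set set \<Rightarrow> 'a set \<Rightarrow> bool" where
  "hamiltonian E S \<longleftrightarrow> (\<exists>q. closes_up E q \<and> set q = S)"

text \<open>A Hamiltonian cycle that appears when \<open>{u, v}\<close> is added must use this edge; cutting it there leaves a
Hamiltonian path from \<open>u\<close> to \<open>v\<close> that avoids it.\<close>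

lemma hamiltonian_path_of_added_edge:
  assumes q: "closes_up (insert {u, v} F) q" and no: "\<not> closes_up F q"
  shows "\<exists>p. is_path F p \<and> set p = set q \<and> p \<noteq> [] \<and> {hd p, last p} = {u, v}"
proof -
  let ?F = "insert {u, v} F"
  have dist: "distinct q" and suc: "successively (\<lambda>x y. {x, y} \<in> ?F) q"
    and len: "3 \<le> length q" and clo: "{hd q, last q} \<in> ?F"
    using q by (auto simp: closes_up_def is_path_def)
  show ?thesis
  proof (cases "successively (\<lambda>x y. {x, y} \<in> F) q")
    case True
    hence "{hd q, last q} = {u, v}"
      using no clo dist len by (auto simp: closes_up_def is_path_def)
    thus ?thesis using True dist len by (intro exI[of _ q]) (auto simp: is_path_def)
  next
    case False
    then obtain i where i: "Suc i < length q" "{q ! i, q ! Suc i} \<notin> F"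
      by (auto simp: successively_conv_nth)
    define A where "A = take (Suc i) q"
    define B where "B = drop (Suc i) q"
    have qAB: "q = A @ B" by (simp add: A_def B_def)
    have ne: "A \<noteq> []" "B \<noteq> []" using i by (auto simp: A_def B_def)
    have lA: "last A = q ! i" and hB: "hd B = q ! Suc i"
      using i by (simp_all add: A_def B_def take_Suc_conv_app_nth hd_drop_conv_nth)
    have uv: "{last A, hd B} = {u, v}"
    proof -
      have "{q ! i, q ! Suc i} \<in> ?F" using suc i(1) by (simp add: successively_conv_nth)
      thus ?thesis using i(2) lA hB by auto
    qed
    have dAB: "set A \<inter> set B = {}" "distinct A" "distinct B" using dist qAB by auto
    have keep: "{x, y} \<in> F" if "{x, y} \<in> ?F" "{x, y} \<subseteq> set A \<or> {x, y} \<subseteq> set B" for x y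
    proof -
      have "{x, y} \<noteq> {last A, hd B}"
        using that(2) dAB(1) ne by (metis disjoint_iff hd_in_set insert_subset last_in_set)
      thus ?thesis using that(1) uv by auto
    qed
    have sA: "successively (\<lambda>x y. {x, y} \<in> ?F) A" and sB: "successively (\<lambda>x y. {x, y} \<in> ?F) B"
      using suc unfolding qAB successively_append_iff by blast+
    have "successively (\<lambda>x y. {x, y} \<in> F) A"
      using sA by (rule successively_mono) (erule keep, simp)
    moreover have "successively (\<lambda>x y. {x, y} \<in> F) B"
      using sB by (rule successively_mono) (erule keep, simp)
    ultimately have pA: "is_path F A" and pB: "is_path F B" using dAB by (auto simp: is_path_def)
    have "{last B, hd A} \<in> ?F" using clo ne by (simp add: qAB insert_commute)
    moreover have "{last B, hd A} \<noteq> {last A, hd B}"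
    proof
      assume "{last B, hd A} = {last A, hd B}"
      hence "last B = hd B" "hd A = last A"
        using dAB(1) ne by (metis disjoint_iff doubleton_eq_iff hd_in_set last_in_set)+
      hence "length A = 1" "length B = 1"
        using dAB(2,3) ne by (metis One_nat_def distinct.simps(2) last.simps last_in_set length_Cons list.exhaust_sel list.size(3))+
      thus False using len qAB by simp
    qed
    ultimately have "{last B, hd A} \<in> F" using uv by auto
    hence "is_path F (B @ A)" using pA pB dAB ne by (auto simp: is_path_append)
    moreover have "{hd (B @ A), last (B @ A)} = {u, v}" using ne uv by auto
    ultimately show ?thesis using ne qAB by (intro exI[of _ "B @ A"]) auto
  qed
qed

text \<open>Ore's argument: with this degree sum there are consecutive vertices \<open>s\<close>, \<open>t\<close> of the path such that
\<open>s\<close> is adjacent to its end and \<open>t\<close> to its start. Reversing the part from \<open>t\<close> on gives the cycle.\<close>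

lemma hamiltonian_of_crossing_ends:
  assumes E: "\<forall>e\<in>F. card e = 2" and p: "is_path F p" and len: "3 \<le> length p"
    and deg: "card (nbrs F (set p) (hd p)) + card (nbrs F (set p) (last p)) \<ge> length p"
  shows "hamiltonian F (set p)"
proof -
  have loop: "{v, v} \<notin> F" for v using E by fastforce
  define m where "m = length p"
  have dist: "distinct p" using p by (simp add: is_path_def)
  have ne: "p \<noteq> []" using len by auto
  have ends: "hd p = p ! 0" "last p = p ! (m - 1)"
    using ne by (simp_all add: hd_conv_nth last_conv_nth m_def)
  define A where "A = {k. k < m \<and> {p ! k, hd p} \<in> F}"
  define B where "B = {k. k < m \<and> {p ! k, last p} \<in> F}"
  have cA: "card A = card (nbrs F (set p) (hd p))"
    and cB: "card B = card (nbrs F (set p) (last p))"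
    using card_nbrs_eq_card_indices[OF dist, of F "set p"] by (auto simp: A_def B_def m_def nbrs_def)
  have "A \<subseteq> {1..<m}"
    using loop[of "p ! 0"] ends by (auto simp: A_def Suc_le_eq intro!: gr0I)
  moreover have "Suc ` B \<subseteq> {1..<m}"
  proof -
    have "Suc k < m" if "k \<in> B" for k
    proof -
      have "k < m" "{p ! k, p ! (m - 1)} \<in> F" using that ends by (auto simp: B_def)
      hence "k \<noteq> m - 1" using loop by auto
      thus ?thesis using \<open>k < m\<close> by simp
    qed
    thus ?thesis by auto
  qed
  ultimately have "card (A \<union> Suc ` B) \<le> card {1..<m}" by (intro card_mono) auto
  hence "card (A \<union> Suc ` B) < card A + card (Suc ` B)"
    using deg len by (simp add: cA cB card_image m_def)
  moreover have "finite A" "finite B" by (simp_all add: A_def B_def)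
  ultimately have "A \<inter> Suc ` B \<noteq> {}"
    using card_Un_disjoint[of A "Suc ` B"] by force
  then obtain i where i: "Suc i < m" "{p ! Suc i, hd p} \<in> F" "{p ! i, last p} \<in> F"
    by (auto simp: A_def B_def)
  define P where "P = take (Suc i) p"
  define Q where "Q = drop (Suc i) p"
  have pPQ: "p = P @ Q" by (simp add: P_def Q_def)
  have nePQ: "P \<noteq> []" "Q \<noteq> []" using i ne by (auto simp: P_def Q_def m_def)
  have "last P = p ! i" "hd Q = p ! Suc i"
    using i by (simp_all add: P_def Q_def take_Suc_conv_app_nth hd_drop_conv_nth m_def)
  moreover have "hd P = hd p" "last Q = last p" using nePQ by (simp_all add: pPQ)
  ultimately have "closes_up F (P @ rev Q)"
    using p len i nePQ unfolding closes_up_def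
    by (auto simp: pPQ is_path_append hd_rev last_rev insert_commute)
  thus ?thesis unfolding hamiltonian_def using pPQ by (intro exI[of _ "P @ rev Q"]) simp
qed

text \<open>The Bondy--Chvatal closure, obtained without iteration: unless the graph is already Hamiltonian, take
an edge-maximal non-Hamiltonian graph on \<open>S\<close> above it. There a non-adjacent pair is joined by a
Hamiltonian path, so by Ore's argument its degree sum is smaller than \<open>card S\<close>.\<close>

lemma closure_reflects_hamiltonian:
  assumes fin: "finite S" and E: "\<forall>e\<in>E. card e = 2"
  obtains F where "\<forall>e\<in>F. card e = 2" "inside E S \<subseteq> F" "hamiltonian F S \<Longrightarrow> hamiltonian E S"
    "\<And>u v. u \<in> S \<Longrightarrow> v \<in> S \<Longrightarrow> u \<noteq> v \<Longrightarrow>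
       card S \<le> card (nbrs F S u) + card (nbrs F S v) \<Longrightarrow> {u, v} \<in> F"
proof (cases "hamiltonian E S")
  case True
  \<comment> \<open>If the graph is Hamiltonian, the complete graph meets all requirements.\<close>
  show ?thesis
    by (rule that[of "{e. card e = 2}"]) (use E True in \<open>auto simp: inside_def card_insert_if\<close>)
next
  case False
  let ?K = "{e. e \<subseteq> S \<and> card e = 2}"
  let ?C = "{F. inside E S \<subseteq> F \<and> F \<subseteq> ?K \<and> \<not> hamiltonian F S}"
  have "finite ?K" using fin by simp
  hence "finite ?C" by (rule finite_subset[rotated, OF finite_Pow_iff[THEN iffD2]]) auto
  moreover have "\<not> hamiltonian (inside E S) S"
    using False by (auto simp: hamiltonian_def closes_up_def is_path_def inside_def elim!: successively_mono[rotated])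
  hence "inside E S \<in> ?C" using E by (auto simp: inside_def)
  ultimately obtain F where F: "F \<in> ?C" and Fmax: "\<And>F'. F' \<in> ?C \<Longrightarrow> F \<subseteq> F' \<Longrightarrow> F = F'"
    by (metis (no_types, lifting) finite_has_maximal2)
  have F2: "\<forall>e\<in>F. card e = 2" using F by auto
  show ?thesis
  proof (rule that[of F])
    show "\<forall>e\<in>F. card e = 2" by (rule F2)
    show "inside E S \<subseteq> F" using F by simp
    show "hamiltonian F S \<Longrightarrow> hamiltonian E S" using F by simp
    fix u v assume uv: "u \<in> S" "v \<in> S" "u \<noteq> v" and deg: "card S \<le> card (nbrs F S u) + card (nbrs F S v)"
    show "{u, v} \<in> F"
    proof (rule ccontr)
      assume "{u, v} \<notin> F"
      hence "insert {u, v} F \<notin> ?C" using Fmax[of "insert {u, v} F"] by blast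
      moreover have "insert {u, v} F \<subseteq> ?K" "inside E S \<subseteq> insert {u, v} F" using F uv by auto
      ultimately have "hamiltonian (insert {u, v} F) S" by blast
      then obtain q where q: "closes_up (insert {u, v} F) q" "set q = S" by (auto simp: hamiltonian_def)
      have "\<not> closes_up F q" using F q(2) by (auto simp: hamiltonian_def)
      then obtain p where p: "is_path F p" "set p = S" "p \<noteq> []" "{hd p, last p} = {u, v}"
        using hamiltonian_path_of_added_edge[OF q(1)] q(2) by auto
      have "length p = card S" "length q = card S"
        using p(1,2) q by (auto simp: is_path_def closes_up_def dest!: distinct_card)
      moreover have "card (nbrs F S (hd p)) + card (nbrs F S (last p)) = card (nbrs F S u) + card (nbrs F S v)"
        using p(4) by (auto simp: doubleton_eq_iff)
      ultimately have "hamiltonian F (set p)"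
        using q(1) deg p(2) by (intro hamiltonian_of_crossing_ends[OF F2 p(1)]) (auto simp: closes_up_def)
      thus False using F p(2) by simp
    qed
  qed
qed

lemma hamiltonian_complete:
  assumes "finite S" "3 \<le> card S" "\<And>u v. u \<in> S \<Longrightarrow> v \<in> S \<Longrightarrow> u \<noteq> v \<Longrightarrow> {u, v} \<in> F"
  shows "hamiltonian F S"
proof -
  obtain q where q: "set q = S" "distinct q" using assms(1) finite_distinct_list by blast
  have len: "length q = card S" using q distinct_card by metis
  have "successively (\<lambda>x y. {x, y} \<in> F) q"
    unfolding successively_conv_nth using assms(3) q
    by (metis Suc_lessD n_not_Suc_n nth_eq_iff_index_eq nth_mem)
  moreover have "hd q \<noteq> last q"
    using q len assms(2) by (cases q) (auto split: if_splits simp: last_in_set)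
  hence "{hd q, last q} \<in> F" using assms(2,3) q len
    by (metis card.empty hd_in_set last_in_set list.set(1) not_numeral_le_zero)
  ultimately show ?thesis using q len assms(2) by (auto simp: hamiltonian_def closes_up_def is_path_def)
qed

text \<open>In the closure \<open>W\<close> first becomes complete; then each \<open>y\<close> becomes adjacent to all of \<open>W\<close>, since the
vertices of \<open>W\<close> now have degree at least \<open>card W - 1\<close>; and then \<open>Y\<close> becomes complete, too.\<close>

lemma hamiltonian_dense_plus_attached:
  assumes E: "\<forall>e\<in>E. card e = 2" and fin: "finite W" "finite Y" and disj: "W \<inter> Y = {}"
    and three: "3 \<le> card (W \<union> Y)"
    and W: "\<And>w. w \<in> W \<Longrightarrow> card (W \<union> Y) \<le> 2 * card (nbrs E W w)"
    and Y: "\<And>y. y \<in> Y \<Longrightarrow> card (W \<union> Y) < card W + card (nbrs E W y)"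
    and half: "card (W \<union> Y) \<le> 2 * card W"
  shows "hamiltonian E (W \<union> Y)"
proof -
  let ?S = "W \<union> Y"
  have finS: "finite ?S" using fin by simp
  obtain F where F: "\<forall>e\<in>F. card e = 2" "inside E ?S \<subseteq> F" "hamiltonian F ?S \<Longrightarrow> hamiltonian E ?S"
    and clos: "\<And>u v. u \<in> ?S \<Longrightarrow> v \<in> ?S \<Longrightarrow> u \<noteq> v \<Longrightarrow>
       card ?S \<le> card (nbrs F ?S u) + card (nbrs F ?S v) \<Longrightarrow> {u, v} \<in> F"
    using closure_reflects_hamiltonian[OF finS E] by metis
  have deg: "card (nbrs E W v) \<le> card (nbrs F ?S v)" if "v \<in> ?S" for v
    using F(2) that finS by (intro card_mono) (auto simp: nbrs_def inside_def)
  have WW: "{u, v} \<in> F" if "u \<in> W" "v \<in> W" "u \<noteq> v" for u v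
    using clos[of u v] that W[of u] W[of v] deg[of u] deg[of v] by simp
  have degW: "card W - 1 \<le> card (nbrs F ?S w)" if "w \<in> W" for w
  proof -
    have "W - {w} \<subseteq> nbrs F ?S w" using WW that by (auto simp: nbrs_def)
    hence "card (W - {w}) \<le> card (nbrs F ?S w)" using finS by (intro card_mono finite_nbrs)
    thus ?thesis using that fin by simp
  qed
  have WY: "{w, y} \<in> F" if "w \<in> W" "y \<in> Y" for w y
    using clos[of w y] that Y[of y] degW[of w] deg[of y] disj by fastforce
  have degY: "card W \<le> card (nbrs F ?S y)" if "y \<in> Y" for y
    using WY that finS by (intro card_mono finite_nbrs) (auto simp: nbrs_def)
  have YY: "{u, v} \<in> F" if "u \<in> Y" "v \<in> Y" "u \<noteq> v" for u v
    using clos[of u v] that degY[of u] degY[of v] half by simp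
  have "{u, v} \<in> F" if "u \<in> ?S" "v \<in> ?S" "u \<noteq> v" for u v
    using that WW WY YY by (metis Un_iff insert_commute)
  hence "hamiltonian F ?S" by (rule hamiltonian_complete[OF finS three])
  thus ?thesis by (rule F(3))
qed

text \<open>The right-hand side counts each non-adjacent pair in \<open>Q\<close> twice, and a vertex of degree less than \<open>t\<close>
is in more than \<open>card Q - 1 - t\<close> such pairs.\<close>

lemma card_low_degree_le:
  assumes E: "\<forall>e\<in>E. card e = 2" and Q: "finite Q"
  shows "real (card {v \<in> Q. real (card (nbrs E Q v)) < t}) * (real (card Q) - 1 - t)
    \<le> real (card Q) * (real (card Q) - 1) - 2 * real (card (inside E Q))"
proof -
  let ?a = "real (card Q)" and ?B = "{v \<in> Q. real (card (nbrs E Q v)) < t}"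
  let ?g = "\<lambda>v. ?a - 1 - real (card (nbrs E Q v))"
  have loop: "{v, v} \<notin> E" for v using E by fastforce
  have g0: "0 \<le> ?g v" if "v \<in> Q" for v
  proof -
    have "nbrs E Q v \<subseteq> Q - {v}" using loop by (auto simp: nbrs_def)
    hence "card (nbrs E Q v) \<le> card (Q - {v})" using Q by (intro card_mono) auto
    moreover have "0 < card Q" using that Q by (auto simp: card_gt_0_iff)
    ultimately show ?thesis using that Q by (simp add: of_nat_diff)
  qed
  have "real (card ?B) * (?a - 1 - t) = (\<Sum>v\<in>?B. ?a - 1 - t)" by simp
  also have "\<dots> \<le> (\<Sum>v\<in>?B. ?g v)" by (intro sum_mono) auto
  also have "\<dots> \<le> (\<Sum>v\<in>Q. ?g v)" using Q g0 by (intro sum_mono2) auto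
  also have "\<dots> = ?a * (?a - 1) - real (\<Sum>v\<in>Q. card (nbrs E Q v))"
    by (simp add: sum_subtractf)
  finally show ?thesis by (simp add: sum_card_nbrs[OF E Q])
qed

section \<open>Graphs without long cycles\<close>

text \<open>The lower bound 4 for \<open>C\<close> makes every degree above \<open>C / 2\<close> an integer of at least 3, so that the
end block lemma applies.\<close>

locale short_cycles =
  fixes V0 :: "'a set" and E :: "'a set set" and C :: real
  assumes finite_V0: "finite V0" and edge_card: "\<forall>e\<in>E. card e = 2" and C_ge: "4 \<le> C"
    and short: "\<And>q. closes_up E q \<Longrightarrow> set q \<subseteq> V0 \<Longrightarrow> real (length q) < C"
begin

text \<open>How far the number of edges stays below the linear Erdos--Gallai bound. The deficit never increases
when a vertex of degree at most \<open>C / 2\<close> or the interior of an end block is deleted, so a small deficit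
is inherited by every graph that arises from such deletions.\<close>

definition deficit :: "'a set \<Rightarrow> real" where
  "deficit V = C * real (card V) / 2 - real (card (inside E V))"

lemma no_loop: "{v, v} \<notin> E"
  using edge_card by fastforce

lemma finite_sub: "V \<subseteq> V0 \<Longrightarrow> finite V"
  using finite_V0 finite_subset by blast

lemma deficit_remove_vertex:
  assumes "V \<subseteq> V0" "v \<in> V" "real (card (nbrs E V v)) \<le> C / 2"
  shows "deficit (V - {v}) \<le> deficit V"
proof -
  have fin: "finite V" using assms(1) finite_sub by blast
  have "nbrs E (V - {v}) v = nbrs E V v" using no_loop by (auto simp: nbrs_def)
  moreover have "card (inside E V) = card (inside E (V - {v})) + card (nbrs E (V - {v}) v)"
    using card_inside_insert[OF edge_card, of "V - {v}" v] fin assms(2) by (simp add: insert_absorb)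
  moreover have "card V = Suc (card (V - {v}))" using fin assms(2) by (metis card_Suc_Diff1)
  ultimately show ?thesis using assms(3) by (simp add: deficit_def field_simps)
qed

text \<open>The last inequality holds because every edge within \<open>V\<close> that meets \<open>W\<close> lies inside \<open>insert x W\<close>.\<close>

lemma block_of_high_degrees:
  assumes V: "V \<subseteq> V0" "V \<noteq> {}" and deg: "\<And>v. v \<in> V \<Longrightarrow> C / 2 < real (card (nbrs E V v))"
  obtains W x where "insert x W \<subseteq> V" "x \<notin> W" "\<And>w. w \<in> W \<Longrightarrow> nbrs E V w \<subseteq> insert x W"
    "real (card W) + 1 < C" "C / 2 < real (card W)"
    "deficit (V - W) + C * real (card W) / 2 - real (card (inside E (insert x W))) \<le> deficit V"
proof -
  have fin: "finite V" using V finite_sub by blast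
  \<comment> \<open>the least integer above \<open>C / 2\<close>\<close>
  define d where "d = nat \<lfloor>C / 2\<rfloor> + 1"
  have "real d = real_of_int \<lfloor>C / 2\<rfloor> + 1" using C_ge by (simp add: d_def)
  hence Cd: "C < 2 * real d" by linarith
  have d2: "2 \<le> d" using C_ge unfolding d_def by linarith
  have dd: "d \<le> card (nbrs E V v)" if "v \<in> V" for v
    using deg[OF that] C_ge unfolding d_def by linarith
  have "length q < 2 * d" if "closes_up E q" "set q \<subseteq> V" for q
    using short[OF that(1)] that(2) V(1) Cd by fastforce
  then obtain W x q where q: "closes_up E q" "set q = insert x W" "insert x W \<subseteq> V" "x \<notin> W"
    and nb: "\<And>w. w \<in> W \<Longrightarrow> nbrs E V w \<subseteq> insert x W"
    using end_block[OF fin V(2) edge_card d2 dd] by metis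
  have finW: "finite W" using q(3) fin by (meson finite_subset insert_subset)
  have "length q = card (insert x W)" using q by (metis closes_up_def distinct_card is_path_def)
  hence len: "length q = card W + 1" using q(4) finW by simp
  have lt: "real (card W) + 1 < C" using short[OF q(1)] q(2,3) V(1) len by fastforce
  have "card W \<noteq> 0" using q(1) len by (auto simp: closes_up_def)
  then obtain w where w: "w \<in> W" by (metis card.empty ex_in_conv)
  have "nbrs E V w \<subseteq> insert x W - {w}" using nb[OF w] no_loop by (auto simp: nbrs_def)
  hence "card (nbrs E V w) \<le> card (insert x W - {w})" using finW by (intro card_mono) auto
  also have "\<dots> = card W" using w q(4) finW by (subst card_Diff_singleton) auto
  finally have gt: "C / 2 < real (card W)" using deg[of w] w q(3) by force
  have "inside E V \<subseteq> inside E (V - W) \<union> inside E (insert x W)"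
  proof
    fix e assume e: "e \<in> inside E V"
    hence "card e = 2" "e \<in> E" "e \<subseteq> V" using edge_card by (auto simp: inside_def)
    then obtain s t where st: "e = {s, t}" by (meson card_2_iff)
    show "e \<in> inside E (V - W) \<union> inside E (insert x W)"
    proof (cases "s \<in> W \<or> t \<in> W")
      case True
      moreover have "{s, t} \<in> E" "{t, s} \<in> E" "s \<in> V" "t \<in> V"
        using st \<open>e \<in> E\<close> \<open>e \<subseteq> V\<close> by (auto simp: insert_commute)
      ultimately have "e \<subseteq> insert x W"
        using nb[of s] nb[of t] st unfolding nbrs_def by blast
      thus ?thesis using \<open>e \<in> E\<close> by (simp add: inside_def)
    next
      case False
      thus ?thesis using \<open>e \<in> E\<close> \<open>e \<subseteq> V\<close> st by (auto simp: inside_def)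
    qed
  qed
  hence "card (inside E V) \<le> card (inside E (V - W) \<union> inside E (insert x W))"
    using fin finW by (intro card_mono) (auto intro: finite_inside)
  also have "\<dots> \<le> card (inside E (V - W)) + card (inside E (insert x W))" by (rule card_Un_le)
  finally have "real (card (inside E V)) \<le> real (card (inside E (V - W))) + real (card (inside E (insert x W)))"
    by linarith
  moreover have "real (card V) = real (card (V - W)) + real (card W)"
    using q(3) fin finW by (simp add: card_Diff_subset card_mono of_nat_diff)
  ultimately have "deficit (V - W) + C * real (card W) / 2 - real (card (inside E (insert x W))) \<le> deficit V"
    by (simp add: deficit_def field_simps)
  with q(3,4) nb lt gt show ?thesis by (rule that)
qed

lemma card_inside_le_real:
  assumes "finite Q" "0 < card Q"
  shows "2 * real (card (inside E Q)) \<le> real (card Q) * (real (card Q) - 1)"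
proof -
  have "real (2 * card (inside E Q)) \<le> real (card Q * (card Q - 1))"
    using card_inside_le[OF edge_card assms(1)] by linarith
  thus ?thesis using assms(2) by (simp add: of_nat_diff)
qed

text \<open>The Erdos--Gallai theorem for cycles, up to the lower order term: delete vertices of degree at most
\<open>C / 2\<close>; when there are none, an end block has at most \<open>C\<close> vertices, so deleting its interior \<open>W\<close>
costs at most \<open>C * card W / 2\<close> edges.\<close>

lemma deficit_nonneg: "V \<subseteq> V0 \<Longrightarrow> 0 \<le> deficit V"
proof (induction "card V" arbitrary: V rule: less_induct)
  case less
  have fin: "finite V" using less finite_sub by blast
  show ?case
  proof (cases "\<forall>v\<in>V. C / 2 < real (card (nbrs E V v))")
    case False
    then obtain v where v: "v \<in> V" "real (card (nbrs E V v)) \<le> C / 2" by force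
    have "card (V - {v}) < card V" using v fin by (meson card_Diff1_less)
    hence "0 \<le> deficit (V - {v})" using less by blast
    thus ?thesis using deficit_remove_vertex[OF less(2) v] by simp
  next
    case True
    show ?thesis
    proof (cases "V = {}")
      case True
      have "inside E {} = {}" using edge_card by (auto simp: inside_def)
      thus ?thesis using True by (simp add: deficit_def)
    next
      case False
      obtain W x where W: "insert x W \<subseteq> V" "x \<notin> W" "real (card W) + 1 < C" "C / 2 < real (card W)"
        "deficit (V - W) + C * real (card W) / 2 - real (card (inside E (insert x W))) \<le> deficit V"
        using block_of_high_degrees[OF less(2) False] True by metis
      have finW: "finite W" using W(1) fin by (meson finite_subset insert_subset)
      have "0 < card W" using W(4) C_ge by linarith
      hence "card (V - W) < card V" using W(1) fin finW
        by (metis card_0_eq card_seteq double_diff insert_subset less_irrefl linorder_not_le Diff_subset bot.extremum_uniqueI Diff_disjoint inf.absorb_iff2 finite_Diff)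
      hence "0 \<le> deficit (V - W)" using less by blast
      moreover have "2 * real (card (inside E (insert x W))) \<le> C * real (card W)"
      proof -
        have "2 * real (card (inside E (insert x W))) \<le> (real (card W) + 1) * real (card W)"
          using card_inside_le_real[of "insert x W"] finW W(2) by (simp add: add.commute)
        also have "\<dots> \<le> C * real (card W)" using W(3) by (intro mult_right_mono) auto
        finally show ?thesis .
      qed
      ultimately show ?thesis using W(5) by simp
    qed
  qed
qed

text \<open>\<open>V1\<close> is a maximal set that induces minimum degree above \<open>C / 2\<close>. Every larger set then contains a
vertex outside \<open>V1\<close> of degree at most \<open>C / 2\<close>; deleting such vertices one at a time reaches every
intermediate cardinality without increasing the deficit.\<close>

lemma core_and_peeling:
  assumes V: "V \<subseteq> V0"
  obtains V1 where "V1 \<subseteq> V" "\<And>v. v \<in> V1 \<Longrightarrow> C / 2 < real (card (nbrs E V1 v))"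
    "\<And>m. card V1 \<le> m \<Longrightarrow> m \<le> card V \<Longrightarrow>
       \<exists>U. V1 \<subseteq> U \<and> U \<subseteq> V \<and> card U = m \<and> deficit U \<le> deficit V"
proof -
  have fin: "finite V" using V finite_sub by blast
  let ?K = "{X. X \<subseteq> V \<and> (\<forall>v\<in>X. C / 2 < real (card (nbrs E X v)))}"
  have "finite ?K" "{} \<in> ?K" using fin by auto
  then obtain V1 where V1: "V1 \<in> ?K" and mx: "\<And>X. X \<in> ?K \<Longrightarrow> V1 \<subseteq> X \<Longrightarrow> V1 = X"
    by (metis (no_types, lifting) finite_has_maximal2)
  have peel: "\<exists>U. V1 \<subseteq> U \<and> U \<subseteq> V \<and> card U = card V - k \<and> deficit U \<le> deficit V"
    if "k \<le> card V - card V1" for k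
    using that
  proof (induction k)
    case 0
    thus ?case using V1 by (intro exI[of _ V]) auto
  next
    case (Suc k)
    then obtain U where U: "V1 \<subseteq> U" "U \<subseteq> V" "card U = card V - k" "deficit U \<le> deficit V" by auto
    have finU: "finite U" using U(2) fin finite_subset by blast
    have "V1 \<noteq> U" using U(3) Suc.prems by auto
    hence "U \<notin> ?K" using mx U(1) by blast
    then obtain v where v: "v \<in> U" "real (card (nbrs E U v)) \<le> C / 2" using U(2) by force
    have "v \<notin> V1"
    proof
      assume "v \<in> V1"
      hence "C / 2 < real (card (nbrs E V1 v))" using V1 by blast
      also have "\<dots> \<le> real (card (nbrs E U v))"
        using finU U(1) by (intro of_nat_mono card_mono finite_nbrs nbrs_mono)
      finally show False using v(2) by simp
    qed
    moreover have "deficit (U - {v}) \<le> deficit U"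
      using deficit_remove_vertex[OF _ v] U(2) V by blast
    moreover have "card (U - {v}) = card V - Suc k" using U(3) v(1) finU by simp
    ultimately show ?case using U by (intro exI[of _ "U - {v}"]) auto
  qed
  show ?thesis
  proof (rule that[of V1])
    show "V1 \<subseteq> V" "\<And>v. v \<in> V1 \<Longrightarrow> C / 2 < real (card (nbrs E V1 v))" using V1 by auto
    fix m assume "card V1 \<le> m" "m \<le> card V"
    thus "\<exists>U. V1 \<subseteq> U \<and> U \<subseteq> V \<and> card U = m \<and> deficit U \<le> deficit V"
      using peel[of "card V - m"] by simp
  qed
qed

text \<open>With a small deficit the core cannot be empty: peeling down to a set of at most \<open>C / 2\<close> vertices would
leave too few edges, as the deficit does not grow. So the core has an end block, and its removal
can waste little deficit: the block is nearly complete, and its order is nearly \<open>C\<close>. The peeling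
property of the core is passed on because the second phase of the proof looks at the vertices peeled last.\<close>

lemma dense_block:
  assumes V: "V \<subseteq> V0" and def: "deficit V \<le> \<delta>"
    and large: "4 * \<delta> < C * real (card V)" and small: "4 * \<delta> < C * (C / 2 - 1)"
  obtains V1 W x where "V1 \<subseteq> V" "insert x W \<subseteq> V1" "x \<notin> W"
    "\<And>w. w \<in> W \<Longrightarrow> nbrs E V1 w \<subseteq> insert x W"
    "real (card W) + 1 < C" "C * (C - real (card W) - 1) \<le> 4 * \<delta>"
    "(real (card W) + 1) * real (card W) - 2 * real (card (inside E (insert x W))) \<le> 2 * \<delta>"
    "deficit (V1 - W) \<le> \<delta>"
    "\<And>m. card V1 \<le> m \<Longrightarrow> m \<le> card V \<Longrightarrow>
       \<exists>U. V1 \<subseteq> U \<and> U \<subseteq> V \<and> card U = m \<and> deficit U \<le> deficit V"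
proof -
  obtain V1 where V1: "V1 \<subseteq> V" and deg: "\<And>v. v \<in> V1 \<Longrightarrow> C / 2 < real (card (nbrs E V1 v))"
    and peel: "\<And>m. card V1 \<le> m \<Longrightarrow> m \<le> card V \<Longrightarrow>
       \<exists>U. V1 \<subseteq> U \<and> U \<subseteq> V \<and> card U = m \<and> deficit U \<le> deficit V"
    using core_and_peeling[OF V] by metis
  have V10: "V1 \<subseteq> V0" using V1 V by blast
  have ne: "V1 \<noteq> {}"
  proof
    assume e: "V1 = {}"
    \<comment> \<open>A set of \<open>h\<close> vertices with \<open>h \<le> C / 2\<close> has deficit at least \<open>C * h / 4\<close>.\<close>
    define h where "h = min (card V) (nat \<lfloor>C / 2\<rfloor>)"
    have hC: "real h \<le> C / 2" using C_ge unfolding h_def by linarith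
    have "4 * \<delta> < C * real h"
    proof (cases "card V \<le> nat \<lfloor>C / 2\<rfloor>")
      case True thus ?thesis using large by (simp add: h_def)
    next
      case False
      hence "C / 2 - 1 \<le> real h" using C_ge unfolding h_def by linarith
      hence "C * (C / 2 - 1) \<le> C * real h" using C_ge by (intro mult_left_mono) auto
      thus ?thesis using small by simp
    qed
    obtain U where U: "U \<subseteq> V" "card U = h" "deficit U \<le> deficit V"
      using peel[of h] e by (auto simp: h_def)
    have finU: "finite U" using U(1) V finite_sub by blast
    have "2 * real (card (inside E U)) \<le> real h * (C / 2)"
    proof (cases "h = 0")
      case True
      hence "U = {}" using U finU by simp
      moreover have "inside E {} = {}" using edge_card by (auto simp: inside_def)
      ultimately show ?thesis using True by simp
    next
      case False
      hence "2 * real (card (inside E U)) \<le> real h * (real h - 1)"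
        using card_inside_le_real[OF finU] U(2) by simp
      also have "\<dots> \<le> real h * (C / 2)" using hC by (intro mult_left_mono) auto
      finally show ?thesis .
    qed
    hence "C * real h / 4 \<le> deficit U" by (simp add: deficit_def U(2) field_simps)
    thus False using U(3) def \<open>4 * \<delta> < C * real h\<close> by simp
  qed
  obtain W x where W: "insert x W \<subseteq> V1" "x \<notin> W" "\<And>w. w \<in> W \<Longrightarrow> nbrs E V1 w \<subseteq> insert x W"
    "real (card W) + 1 < C" "C / 2 < real (card W)"
    "deficit (V1 - W) + C * real (card W) / 2 - real (card (inside E (insert x W))) \<le> deficit V1"
    using block_of_high_degrees[OF V10 ne deg] by metis
  have "card V1 \<le> card V" using V1 V by (simp add: card_mono finite_sub)
  then obtain U where U: "V1 \<subseteq> U" "U \<subseteq> V" "card U = card V1" "deficit U \<le> deficit V"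
    using peel[of "card V1"] by auto
  hence "U = V1" using V finite_sub by (metis card_subset_eq finite_subset)
  hence d1: "deficit V1 \<le> \<delta>" using U(4) def by simp
  have finW: "finite W" using W(1) V10 finite_sub by (meson finite_subset insert_subset)
  have ins: "2 * real (card (inside E (insert x W))) \<le> (real (card W) + 1) * real (card W)"
    using card_inside_le_real[of "insert x W"] finW W(2) by (simp add: add.commute)
  have C1: "(real (card W) + 1) * real (card W) \<le> C * real (card W)"
    using W(4) by (intro mult_right_mono) auto
  have nn: "0 \<le> deficit (V1 - W)" using deficit_nonneg V10 by blast
  show ?thesis
  proof (rule that[OF V1 W(1,2,3,4) _ _ _ peel])
    show "deficit (V1 - W) \<le> \<delta>" using W(6) d1 ins C1 by simp
    show "(real (card W) + 1) * real (card W) - 2 * real (card (inside E (insert x W))) \<le> 2 * \<delta>"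
      using W(6) d1 nn C1 by simp
    have "real (card W) * (C - real (card W) - 1) \<le> 2 * \<delta>"
      using W(6) d1 nn ins by (simp add: field_simps)
    moreover have "C / 2 * (C - real (card W) - 1) \<le> real (card W) * (C - real (card W) - 1)"
      using W(4,5) by (intro mult_right_mono) auto
    ultimately show "C * (C - real (card W) - 1) \<le> 4 * \<delta>" by simp
  qed
qed

end

section \<open>The two structures of a nearly extremal graph\<close>

text \<open>The quantity that measures all errors is \<open>\<gamma> * real n\<close>. It is at least one half, so it also absorbs
additive constants, and it is tiny compared to \<open>real n\<close>.\<close>

locale near_extremal = short_cycles +
  fixes n :: nat and \<alpha> \<gamma> :: real
  assumes card_V0: "card V0 = n" and C_eq: "C = (1 / 2 + \<alpha>) * real n"
    and alpha: "0 < \<alpha>" "\<alpha> \<le> \<gamma>" and gamma: "\<gamma> < 3 / 10 ^ 5" "1 / 2 \<le> \<gamma> * real n"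
    and deficit_V0: "deficit V0 \<le> \<gamma> * (real n)\<^sup>2 / 2"
begin

lemma n_pos: "0 < real n"
  using gamma by (cases "n = 0") auto

lemma g_le: "\<gamma> * real n \<le> 3 / 10 ^ 5 * real n"
  using gamma(1) by (intro mult_right_mono) auto

lemma C_bounds: "real n / 2 < C" "C \<le> real n / 2 + \<gamma> * real n"
proof -
  have "0 < \<alpha> * real n" using alpha n_pos by simp
  moreover have "\<alpha> * real n \<le> \<gamma> * real n" using alpha(2) by (intro mult_right_mono) auto
  moreover have "C = real n / 2 + \<alpha> * real n" by (simp add: C_eq field_simps)
  ultimately show "real n / 2 < C" "C \<le> real n / 2 + \<gamma> * real n" by linarith+
qed

text \<open>\<open>T\<close> keeps the vertices of the block whose degree is at least \<open>9 / 20 * real n\<close>. The block has nearly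
\<open>n / 2\<close> vertices, so each vertex outside \<open>T\<close> misses about \<open>n / 20\<close> of them, while only
\<open>\<gamma> * n\<^sup>2 / 2\<close> pairs are missing altogether; hence the constant 21.\<close>

lemma near_clique_block:
  assumes V: "V \<subseteq> V0" "deficit V \<le> \<gamma> * (real n)\<^sup>2 / 2" "4 * (\<gamma> * real n) < real (card V)"
  obtains V1 W x T where "V1 \<subseteq> V" "insert x W \<subseteq> V1" "x \<notin> W"
    "\<And>w. w \<in> W \<Longrightarrow> nbrs E V1 w \<subseteq> insert x W"
    "real (card W) + 1 < C" "C - 4 * (\<gamma> * real n) \<le> real (card W) + 1"
    "T \<subseteq> W" "real (card W) - real (card T) \<le> 21 * (\<gamma> * real n)"
    "\<And>v. v \<in> T \<Longrightarrow> 9 / 20 * real n \<le> real (card (nbrs E (insert x W) v))"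
    "deficit (V1 - W) \<le> \<gamma> * (real n)\<^sup>2 / 2"
    "\<And>m. card V1 \<le> m \<Longrightarrow> m \<le> card V \<Longrightarrow>
       \<exists>U. V1 \<subseteq> U \<and> U \<subseteq> V \<and> card U = m \<and> deficit U \<le> deficit V"
proof -
  define N where "N = real n"
  define g where "g = \<gamma> * N"
  have N: "0 < N" and g: "g \<le> 3 / 10 ^ 5 * N" "1 / 2 \<le> g" and C: "N / 2 < C" "C \<le> N / 2 + g"
    using n_pos g_le gamma(2) C_bounds by (simp_all add: N_def g_def)
  have del: "\<gamma> * (real n)\<^sup>2 / 2 = g * N / 2" by (simp add: g_def N_def power2_eq_square)
  have "4 * (g * N / 2) = N / 2 * (4 * g)" by simp
  also have "\<dots> \<le> C * (4 * g)" using C g by (intro mult_right_mono) auto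
  also have "\<dots> < C * real (card V)"
    using V(3) C_ge by (intro mult_strict_left_mono) (auto simp: g_def N_def)
  finally have large: "4 * (g * N / 2) < C * real (card V)" .
  have "4 * (g * N / 2) = N / 2 * (4 * g)" by simp
  also have "\<dots> \<le> C * (4 * g)" using C g by (intro mult_right_mono) auto
  also have "\<dots> < C * (C / 2 - 1)"
    using C_ge C g N by (intro mult_strict_left_mono) auto
  finally have small: "4 * (g * N / 2) < C * (C / 2 - 1)" .
  obtain V1 W x where W: "V1 \<subseteq> V" "insert x W \<subseteq> V1" "x \<notin> W"
    "\<And>w. w \<in> W \<Longrightarrow> nbrs E V1 w \<subseteq> insert x W"
    "real (card W) + 1 < C" "C * (C - real (card W) - 1) \<le> 4 * (g * N / 2)"
    "(real (card W) + 1) * real (card W) - 2 * real (card (inside E (insert x W))) \<le> 2 * (g * N / 2)"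
    "deficit (V1 - W) \<le> g * N / 2"
    "\<And>m. card V1 \<le> m \<Longrightarrow> m \<le> card V \<Longrightarrow>
       \<exists>U. V1 \<subseteq> U \<and> U \<subseteq> V \<and> card U = m \<and> deficit U \<le> deficit V"
    using dense_block[OF V(1) V(2)[unfolded del] large small] by metis
  have finW: "finite W" using W(1,2) V(1) finite_sub by (meson finite_subset insert_subset)
  have Wge: "C - 4 * g \<le> real (card W) + 1"
  proof (rule ccontr)
    assume "\<not> C - 4 * g \<le> real (card W) + 1"
    hence "N / 2 * (4 * g) < C * (C - real (card W) - 1)"
      using C g N by (intro mult_strict_mono) auto
    thus False using W(6) by simp
  qed
  define T where "T = {v \<in> W. 9 / 20 * N \<le> real (card (nbrs E (insert x W) v))}"
  let ?B = "{v \<in> insert x W. real (card (nbrs E (insert x W) v)) < 9 / 20 * N}"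
  have "real (card ?B) * (real (card (insert x W)) - 1 - 9 / 20 * N)
      \<le> real (card (insert x W)) * (real (card (insert x W)) - 1) - 2 * real (card (inside E (insert x W)))"
    using finW by (intro card_low_degree_le[OF edge_card]) auto
  also have "\<dots> = (real (card W) + 1) * real (card W) - 2 * real (card (inside E (insert x W)))"
    using finW W(3) by (simp add: add.commute)
  also have "\<dots> \<le> g * N" using W(7) by simp
  finally have b1: "real (card ?B) * (real (card W) - 9 / 20 * N) \<le> g * N"
    using finW W(3) by simp
  have "real (card ?B) * (N / 21) \<le> real (card ?B) * (real (card W) - 9 / 20 * N)"
    using Wge C g by (intro mult_left_mono) auto
  hence "N * real (card ?B) \<le> N * (21 * g)" using b1 by (simp add: field_simps)
  hence B: "real (card ?B) \<le> 21 * g" using N by simp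
  have "W \<subseteq> T \<union> ?B" by (auto simp: T_def)
  hence "card W \<le> card (T \<union> ?B)" using finW by (intro card_mono) (auto simp: T_def)
  also have "\<dots> \<le> card T + card ?B" by (rule card_Un_le)
  finally have "real (card W) - real (card T) \<le> 21 * g" using B by linarith
  moreover have "T \<subseteq> W" by (auto simp: T_def)
  moreover have "9 / 20 * N \<le> real (card (nbrs E (insert x W) v))" if "v \<in> T" for v
    using that by (simp add: T_def)
  ultimately show ?thesis
    using that[OF W(1,2,3,4,5) _ _ _ _ _ W(9), of T] Wge W(8) by (simp add: g_def N_def power2_eq_square)
qed

lemma card_nbrs_subset_ge:
  assumes "finite Q" "finite S"
  shows "real (card (nbrs E Q v)) - real (card (Q - S)) \<le> real (card (nbrs E S v))"
proof -
  have "nbrs E Q v \<subseteq> nbrs E S v \<union> (Q - S)" by (auto simp: nbrs_def)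
  hence "card (nbrs E Q v) \<le> card (nbrs E S v \<union> (Q - S))"
    using assms by (intro card_mono) (auto intro: finite_nbrs)
  also have "\<dots> \<le> card (nbrs E S v) + card (Q - S)" by (rule card_Un_le)
  finally show ?thesis by linarith
qed

text \<open>If many vertices are left after deleting the first block, they still have a small deficit and contain
a second block. Each block has nearly \<open>n / 2\<close> vertices, so together they exhaust almost all vertices.
The first block is joined to the remainder of its core only through \<open>x\<close>, which may lie in the second
block and is therefore removed from it.\<close>

lemma two_sides_of_two_blocks:
  assumes W: "V1 \<subseteq> V0" "insert x W \<subseteq> V1" "x \<notin> W"
    "\<And>w. w \<in> W \<Longrightarrow> nbrs E V1 w \<subseteq> insert x W"
    "real (card W) + 1 < C" "C - 4 * (\<gamma> * real n) \<le> real (card W) + 1"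
    "T \<subseteq> W" "real (card W) - real (card T) \<le> 21 * (\<gamma> * real n)"
    "\<And>v. v \<in> T \<Longrightarrow> 9 / 20 * real n \<le> real (card (nbrs E (insert x W) v))"
    "deficit (V1 - W) \<le> \<gamma> * (real n)\<^sup>2 / 2"
    and rest: "4 * (\<gamma> * real n) < real (card (V1 - W))"
  obtains S S' where "S \<subseteq> V0" "S' \<subseteq> V0" "S \<inter> S' = {}"
    "\<And>u v. u \<in> S \<Longrightarrow> v \<in> S' \<Longrightarrow> {u, v} \<notin> E"
    "\<And>X. X \<in> {S, S'} \<Longrightarrow> (1 / 2 - 840 * \<gamma>) * real n < real (card X)"
    "\<And>X. X \<in> {S, S'} \<Longrightarrow> real (card X) < (1 / 2 + 20 * \<gamma>) * real n"
    "\<And>X v. X \<in> {S, S'} \<Longrightarrow> v \<in> X \<Longrightarrow> 3 * real n / 7 \<le> real (card (nbrs E X v))"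
    "real n - real (card S) - real (card S') < 840 * \<gamma> * real n"
proof -
  define N where "N = real n"
  define g where "g = \<gamma> * N"
  have N: "0 < N" and g: "g \<le> 3 / 10 ^ 5 * N" "1 / 2 \<le> g" and C: "N / 2 < C" "C \<le> N / 2 + g"
    using n_pos g_le gamma(2) C_bounds by (simp_all add: N_def g_def)
  have sub: "V1 - W \<subseteq> V0" using W(1) by blast
  obtain V3 W' x' T' where W': "V3 \<subseteq> V1 - W" "insert x' W' \<subseteq> V3" "x' \<notin> W'"
    "real (card W') + 1 < C" "C - 4 * (\<gamma> * real n) \<le> real (card W') + 1"
    "T' \<subseteq> W'" "real (card W') - real (card T') \<le> 21 * (\<gamma> * real n)"
    "\<And>v. v \<in> T' \<Longrightarrow> 9 / 20 * real n \<le> real (card (nbrs E (insert x' W') v))"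
    using near_clique_block[OF sub W(10) rest] by metis
  have finW: "finite W" "finite W'" using W W' sub by (meson finite_sub finite_subset insert_subset)+
  have finT: "finite T" "finite T'" using finW W(7) W'(6) finite_subset by blast+
  let ?S' = "T' - {x}"
  have dT: "real (card (insert x W - T)) \<le> 21 * g + 1"
  proof -
    have "real (card (W - T)) \<le> 21 * g"
      using W(7,8) finW finT by (simp add: card_Diff_subset card_mono of_nat_diff g_def N_def)
    moreover have "card (insert x W - T) \<le> card (insert x (W - T))"
      using finW by (intro card_mono) auto
    hence "card (insert x W - T) \<le> Suc (card (W - T))"
      using card_insert_le_m1 finW by (metis card_insert_if finite_Diff le_SucI le_trans order_refl)
    ultimately show ?thesis by linarith
  qed
  have dT': "real (card (insert x' W' - ?S')) \<le> 21 * g + 2"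
  proof -
    have "real (card (W' - T')) \<le> 21 * g"
      using W'(6,7) finW finT by (simp add: card_Diff_subset card_mono of_nat_diff g_def N_def)
    moreover have "card (insert x' W' - ?S') \<le> card ({x, x'} \<union> (W' - T'))"
      using finW by (intro card_mono) auto
    moreover have "card ({x, x'} \<union> (W' - T')) \<le> card {x, x'} + card (W' - T')" by (rule card_Un_le)
    moreover have "card {x, x'} \<le> 2" by (simp add: card_insert_if)
    ultimately show ?thesis by linarith
  qed
  have cT: "C - 25 * g - 1 \<le> real (card T)" "real (card T) \<le> C - 1"
    using W(5,6,8) card_mono[OF finW(1) W(7)] by (simp_all add: g_def N_def)
  have cT': "C - 25 * g - 2 \<le> real (card ?S')" "real (card ?S') \<le> C - 1"
  proof -
    have "card T' \<le> card ?S' + 1" using finT by (auto simp: card_Diff_singleton_if)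
    thus "C - 25 * g - 2 \<le> real (card ?S')"
      using W'(5,7) by (simp add: g_def N_def)
    have "card ?S' \<le> card W'" using finW W'(6) by (intro card_mono) auto
    thus "real (card ?S') \<le> C - 1" using W'(4) by simp
  qed
  have e: "(1 / 2 - 840 * \<gamma>) * real n = N / 2 - 840 * g" "(1 / 2 + 20 * \<gamma>) * real n = N / 2 + 20 * g"
    "840 * \<gamma> * real n = 840 * g" by (simp_all add: N_def g_def field_simps)
  show ?thesis
  proof (rule that[of T ?S'])
    show "T \<subseteq> V0" "?S' \<subseteq> V0" using W(1,2,7) W'(1,2,6) by blast+
    show "T \<inter> ?S' = {}" using W(7) W'(1,2,6) by auto
    show "{u, v} \<notin> E" if "u \<in> T" "v \<in> ?S'" for u v
    proof
      assume "{u, v} \<in> E"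
      moreover have "v \<in> V1 - W" using that W'(1,2,6) by auto
      ultimately have "v \<in> nbrs E V1 u" by (simp add: nbrs_def insert_commute)
      hence "v \<in> insert x W" using W(4)[of u] that(1) W(7) by blast
      thus False using that(2) \<open>v \<in> V1 - W\<close> by simp
    qed
    show "(1 / 2 - 840 * \<gamma>) * real n < real (card X)" if "X \<in> {T, ?S'}" for X
      unfolding e using that cT(1) cT'(1) C g by auto
    show "real (card X) < (1 / 2 + 20 * \<gamma>) * real n" if "X \<in> {T, ?S'}" for X
      unfolding e using that cT(2) cT'(2) C g by auto
    show "3 * real n / 7 \<le> real (card (nbrs E X v))" if X: "X \<in> {T, ?S'}" "v \<in> X" for X v
    proof (cases "X = T")
      case True
      have "9 / 20 * N \<le> real (card (nbrs E (insert x W) v))" using W(9) X True by (simp add: N_def)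
      hence "3 * N / 7 \<le> real (card (nbrs E T v))"
        using card_nbrs_subset_ge[of "insert x W" T v] finW finT dT g by simp
      thus ?thesis by (simp add: True N_def)
    next
      case False
      hence S: "X = ?S'" using X by simp
      have "9 / 20 * N \<le> real (card (nbrs E (insert x' W') v))" using W'(8) X S by (simp add: N_def)
      hence "3 * N / 7 \<le> real (card (nbrs E ?S' v))"
        using card_nbrs_subset_ge[of "insert x' W'" ?S' v] finW finT dT' g by simp
      thus ?thesis by (simp add: S N_def)
    qed
    show "real n - real (card T) - real (card ?S') < 840 * \<gamma> * real n"
      unfolding e using cT(1) cT'(1) C g by (simp flip: N_def)
  qed
qed

text \<open>This excludes that the core is little more than a single block. Otherwise about half of all vertices
are peeled before the core is reached, and the last \<open>p\<close> of them, with \<open>p\<close> about \<open>n / 50\<close>, account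
for about \<open>p * n / 4\<close> edges. Few of these edges run among the \<open>p\<close> vertices themselves, so many of the
peeled vertices have \<open>18 / 100 * n\<close> neighbours in the dense part \<open>T\<close> of the block. Adding
them to \<open>T\<close> gives a Hamiltonian graph, and there are enough of them to make up for the few vertices by
which \<open>T\<close> falls short of \<open>C\<close>.\<close>

lemma many_vertices_outside_block:
  assumes W: "V1 \<subseteq> V0" "insert x W \<subseteq> V1" "x \<notin> W"
    "real (card W) + 1 < C" "C - 4 * (\<gamma> * real n) \<le> real (card W) + 1"
    "T \<subseteq> W" "real (card W) - real (card T) \<le> 21 * (\<gamma> * real n)"
    "\<And>v. v \<in> T \<Longrightarrow> 9 / 20 * real n \<le> real (card (nbrs E (insert x W) v))"
    and peel: "\<And>m. card V1 \<le> m \<Longrightarrow> m \<le> card V0 \<Longrightarrow>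
       \<exists>U. V1 \<subseteq> U \<and> U \<subseteq> V0 \<and> card U = m \<and> deficit U \<le> deficit V0"
  shows "4 * (\<gamma> * real n) < real (card (V1 - W))"
proof (rule ccontr)
  assume nrest: "\<not> ?thesis"
  define N where "N = real n"
  define g where "g = \<gamma> * N"
  have N: "0 < N" and g: "g \<le> 3 / 10 ^ 5 * N" "1 / 2 \<le> g" and C: "N / 2 < C" "C \<le> N / 2 + g"
    using n_pos g_le gamma(2) C_bounds by (simp_all add: N_def g_def)
  have rest: "real (card (V1 - W)) \<le> 4 * g" using nrest by (simp add: g_def N_def)
  have finV1: "finite V1" using W(1) finite_sub by blast
  have finW: "finite W" using finV1 W(2) by (meson finite_subset insert_subset)
  have finT: "finite T" using finW W(6) finite_subset by blast
  have cW: "C - 4 * g - 1 \<le> real (card W)" "real (card W) < C - 1"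
    and cT: "real (card W) - 21 * g \<le> real (card T)" "card T \<le> card W"
    using W(4,5,7) card_mono[OF finW W(6)] by (simp_all add: g_def N_def)
  have cV1: "real (card V1) = real (card W) + real (card (V1 - W))"
    using W(2) finV1 finW by (simp add: card_Diff_subset card_mono of_nat_diff)
  define p where "p = nat \<lfloor>N / 50\<rfloor>"
  have p: "N / 50 - 1 \<le> real p" "real p \<le> N / 50" using N unfolding p_def by linarith+
  have "real (card V1 + p) \<le> N" using cV1 cW rest p C g by simp
  hence "card V1 + p \<le> card V0" by (simp add: card_V0 N_def)
  then obtain U where U: "V1 \<subseteq> U" "U \<subseteq> V0" "card U = card V1 + p" "deficit U \<le> deficit V0"
    using peel[of "card V1 + p"] by auto
  have finU: "finite U" using U(2) finite_sub by blast
  define P where "P = U - V1"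
  have finP: "finite P" using finU by (simp add: P_def)
  have cP: "card P = p" using U(1,3) finV1 by (simp add: P_def card_Diff_subset)
  have UP: "V1 \<union> P = U" using U(1) by (auto simp: P_def)
  have "card (inside E (V1 \<union> P)) \<le> card (inside E V1) + (\<Sum>y\<in>P. card (nbrs E (V1 \<union> P) y))"
    by (rule card_inside_Un_le[OF edge_card finV1 finP]) (auto simp: P_def)
  hence s1: "real (card (inside E U)) \<le> real (card (inside E V1)) + (\<Sum>y\<in>P. real (card (nbrs E U y)))"
    unfolding UP by (metis of_nat_add of_nat_mono of_nat_sum)
  have "0 \<le> deficit V1" using deficit_nonneg W(1) by blast
  hence s2: "C * real p / 2 - g * N / 2 \<le> (\<Sum>y\<in>P. real (card (nbrs E U y)))"
    using s1 U(3,4) deficit_V0 by (simp add: deficit_def g_def N_def power2_eq_square field_simps)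
  define Y where "Y = {y \<in> P. 18 / 100 * N \<le> real (card (nbrs E T y))}"
  have finY: "finite Y" using finP by (simp add: Y_def)
  have TU: "T \<subseteq> U" using W(2,6) U(1) by blast
  have "real (card (U - T)) = real (card V1) + real p - real (card T)"
    using card_Diff_subset[OF finT TU] card_mono[OF finU TU] U(3) by linarith
  hence UT: "real (card (U - T)) \<le> 25 * g + N / 50" using cV1 rest cT p by simp
  have each: "real (card (nbrs E U y)) \<le> 201 / 1000 * N + (if y \<in> Y then 53 / 100 * N else 0)" if "y \<in> P" for y
  proof (cases "y \<in> Y")
    case True
    have "card (nbrs E U y) \<le> card U" using finU by (intro card_mono) (auto simp: nbrs_def)
    hence "real (card (nbrs E U y)) \<le> 53 / 100 * N" using U(3) cV1 cW rest p C g by simp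
    thus ?thesis using True N by simp
  next
    case False
    hence "real (card (nbrs E T y)) < 18 / 100 * N" using that by (simp add: Y_def)
    thus ?thesis using card_nbrs_subset_ge[OF finU finT, of y] UT g False by simp
  qed
  have "(\<Sum>y\<in>P. real (card (nbrs E U y))) \<le> (\<Sum>y\<in>P. 201 / 1000 * N + (if y \<in> Y then 53 / 100 * N else 0))"
    by (intro sum_mono each)
  also have "\<dots> = real p * (201 / 1000 * N) + real (card Y) * (53 / 100 * N)"
  proof -
    have "P \<inter> {y. y \<in> Y} = Y" by (auto simp: Y_def)
    thus ?thesis using finP by (simp add: sum.distrib cP sum.If_cases)
  qed
  finally have "C * real p / 2 - g * N / 2 \<le> real p * (201 / 1000 * N) + real (card Y) * (53 / 100 * N)"
    using s2 by linarith
  moreover have "N / 2 * real p \<le> C * real p" using C by (intro mult_right_mono) auto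
  ultimately have "N * (49 / 1000 * real p - g / 2) \<le> N * (53 / 100 * real (card Y))"
    by (simp add: algebra_simps)
  hence "49 / 1000 * real p - g / 2 \<le> 53 / 100 * real (card Y)" using N by simp
  hence cY: "N / 1000 \<le> real (card Y)" using p g N by simp
  have "card Y \<le> p" unfolding cP[symmetric] using finP by (intro card_mono) (auto simp: Y_def)
  hence cY2: "real (card Y) \<le> N / 50" using p by simp
  have disj: "T \<inter> Y = {}" using W(2,6) by (auto simp: Y_def P_def)
  have cTY: "real (card (T \<union> Y)) = real (card T) + real (card Y)"
    using disj finT finY by (simp add: card_Un_disjoint)
  have cl: "C \<le> real (card (T \<union> Y))" using cTY cT cW cY g by simp
  have "hamiltonian E (T \<union> Y)"
  proof (rule hamiltonian_dense_plus_attached[OF edge_card finT finY disj])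
    show "3 \<le> card (T \<union> Y)" using cl C_ge by linarith
    have big: "real (card (T \<union> Y)) \<le> 53 / 100 * N" using cTY cT cW cY2 C g by simp
    show "card (T \<union> Y) \<le> 2 * card (nbrs E T w)" if "w \<in> T" for w
    proof -
      have "insert x W - T \<subseteq> insert x (W - T)" by auto
      hence "card (insert x W - T) \<le> card (insert x (W - T))" using finW by (intro card_mono) auto
      also have "\<dots> = card (W - T) + 1" using finW W(3) by simp
      finally have "real (card (insert x W - T)) \<le> 21 * g + 1"
        using cT finW finT W(6) by (simp add: card_Diff_subset of_nat_diff)
      moreover have "9 / 20 * N \<le> real (card (nbrs E (insert x W) w))" using W(8)[OF that] by (simp add: N_def)
      ultimately have "real (card (T \<union> Y)) \<le> 2 * real (card (nbrs E T w))"
        using card_nbrs_subset_ge[of "insert x W" T w] finW finT big g by simp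
      thus ?thesis by linarith
    qed
    show "card (T \<union> Y) < card T + card (nbrs E T y)" if "y \<in> Y" for y
    proof -
      have "18 / 100 * N \<le> real (card (nbrs E T y))" using that by (simp add: Y_def)
      hence "real (card (T \<union> Y)) < real (card T) + real (card (nbrs E T y))"
        using big cT cW C g N by simp
      thus ?thesis by linarith
    qed
    have "real (card (T \<union> Y)) \<le> 2 * real (card T)" using big cT cW C g N by simp
    thus "card (T \<union> Y) \<le> 2 * card T" by linarith
  qed
  then obtain q where q: "closes_up E q" "set q = T \<union> Y" by (auto simp: hamiltonian_def)
  have "set q \<subseteq> V0" using q(2) TU U(2) by (auto simp: Y_def P_def)
  moreover have "length q = card (T \<union> Y)" using q by (metis closes_up_def distinct_card is_path_def)
  ultimately show False using short[OF q(1)] cl by simp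
qed

lemma two_near_cliques:
  obtains S S' where "S \<subseteq> V0" "S' \<subseteq> V0" "S \<inter> S' = {}"
    "\<And>u v. u \<in> S \<Longrightarrow> v \<in> S' \<Longrightarrow> {u, v} \<notin> E"
    "\<And>X. X \<in> {S, S'} \<Longrightarrow> (1 / 2 - 840 * \<gamma>) * real n < real (card X)"
    "\<And>X. X \<in> {S, S'} \<Longrightarrow> real (card X) < (1 / 2 + 20 * \<gamma>) * real n"
    "\<And>X v. X \<in> {S, S'} \<Longrightarrow> v \<in> X \<Longrightarrow> 3 * real n / 7 \<le> real (card (nbrs E X v))"
    "real n - real (card S) - real (card S') < 840 * \<gamma> * real n"
proof -
  have large: "4 * (\<gamma> * real n) < real (card V0)" using g_le n_pos by (simp add: card_V0)
  obtain V1 W x T where W: "V1 \<subseteq> V0" "insert x W \<subseteq> V1" "x \<notin> W"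
    "\<And>w. w \<in> W \<Longrightarrow> nbrs E V1 w \<subseteq> insert x W"
    "real (card W) + 1 < C" "C - 4 * (\<gamma> * real n) \<le> real (card W) + 1"
    "T \<subseteq> W" "real (card W) - real (card T) \<le> 21 * (\<gamma> * real n)"
    "\<And>v. v \<in> T \<Longrightarrow> 9 / 20 * real n \<le> real (card (nbrs E (insert x W) v))"
    "deficit (V1 - W) \<le> \<gamma> * (real n)\<^sup>2 / 2"
    "\<And>m. card V1 \<le> m \<Longrightarrow> m \<le> card V0 \<Longrightarrow>
       \<exists>U. V1 \<subseteq> U \<and> U \<subseteq> V0 \<and> card U = m \<and> deficit U \<le> deficit V0"
    by (rule near_clique_block[OF subset_refl deficit_V0 large]) (rule that)
  have rest: "4 * (\<gamma> * real n) < real (card (V1 - W))"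
    by (rule many_vertices_outside_block[OF W(1,2,3,5,6,7,8,9,11)])
  show ?thesis by (rule two_sides_of_two_blocks[OF W(1-10) rest]) (assumption+, rule that)
qed

end

section \<open>Components and cycles of a simple graph\<close>

lemma length_le_circumference:
  assumes G: "simple_graph G" and q: "closes_up (edges G) q" "set q \<subseteq> verts G"
  shows "length q \<le> circumference G"
proof -
  have "{q ! i, q ! (Suc i mod length q)} \<in> edges G" if "i < length q" for i
  proof (cases "Suc i < length q")
    case True
    thus ?thesis using q by (auto simp: closes_up_def is_path_def successively_conv_nth)
  next
    case False
    hence i: "Suc i = length q" using that by simp
    hence "q \<noteq> []" by auto
    hence "q ! i = last q" "q ! (Suc i mod length q) = hd q"
      using i by (simp_all add: last_conv_nth hd_conv_nth flip: i)
    moreover have "{last q, hd q} \<in> edges G" using q(1) by (simp add: closes_up_def insert_commute)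
    ultimately show ?thesis by simp
  qed
  hence cyc: "is_cycle G q" using q by (auto simp: is_cycle_def closes_up_def is_path_def)
  have fin: "finite (verts G)" using G by (simp add: simple_graph_def)
  have "{vs. is_cycle G vs} \<subseteq> {vs. set vs \<subseteq> verts G \<and> length vs \<le> card (verts G)}"
    using fin by (auto simp: is_cycle_def) (metis card_mono distinct_card)
  hence "finite {vs. is_cycle G vs}"
    using finite_lists_length_le[OF fin] finite_subset by blast
  thus ?thesis using cyc unfolding circumference_def by (intro Max_ge) auto
qed

text \<open>Two vertices that each have more than half of \<open>S\<close> as neighbours have a common neighbour, so \<open>S\<close> has
diameter at most two.\<close>

lemma reachable_within_half_degree:
  assumes G: "simple_graph G" and S: "S \<subseteq> verts G" "finite S"
    and sep: "\<And>u v. u \<in> S \<Longrightarrow> v \<in> verts G - S \<Longrightarrow> {u, v} \<notin> edges G"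
    and deg: "\<And>v. v \<in> S \<Longrightarrow> card S < 2 * card (nbrs (edges G) S v)"
    and v: "v \<in> S"
  shows "{w. reachable G v w} = S"
proof
  show "{w. reachable G v w} \<subseteq> S"
  proof
    fix w assume "w \<in> {w. reachable G v w}"
    hence "(\<lambda>u v. {u, v} \<in> edges G)\<^sup>*\<^sup>* v w" by (simp add: reachable_def)
    thus "w \<in> S"
    proof induction
      case (step y z)
      have "z \<in> verts G" using step(2) G by (auto simp: simple_graph_def)
      thus ?case using sep step by blast
    qed (rule v)
  qed
  show "S \<subseteq> {w. reachable G v w}"
  proof
    fix w assume w: "w \<in> S"
    let ?N = "nbrs (edges G) S"
    have "?N v \<inter> ?N w \<noteq> {}"
    proof
      assume "?N v \<inter> ?N w = {}"
      hence "card (?N v) + card (?N w) = card (?N v \<union> ?N w)"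
        using S(2) by (simp add: card_Un_disjoint finite_nbrs)
      also have "\<dots> \<le> card S" using S(2) by (intro card_mono) (auto simp: nbrs_def)
      finally show False using deg[OF v] deg[OF w] by linarith
    qed
    then obtain u where "{v, u} \<in> edges G" "{u, w} \<in> edges G" by (auto simp: nbrs_def insert_commute)
    thus "w \<in> {w. reachable G v w}"
      by (auto simp: reachable_def intro: converse_rtranclp_into_rtranclp)
  qed
qed

lemma degree_induced_subgraph:
  assumes G: "simple_graph G" and v: "v \<in> S"
  shows "degree (induced_subgraph G S) v = card (nbrs (edges G) S v)"
proof -
  have "{e \<in> {e \<in> edges G. e \<subseteq> S}. v \<in> e} = (\<lambda>u. {u, v}) ` nbrs (edges G) S v"
  proof (intro equalityI subsetI)
    fix e assume e: "e \<in> {e \<in> {e \<in> edges G. e \<subseteq> S}. v \<in> e}"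
    hence "card e = 2" using G by (auto simp: simple_graph_def)
    then obtain u where "e = {u, v}" using e by (auto simp: card_2_iff)
    thus "e \<in> (\<lambda>u. {u, v}) ` nbrs (edges G) S v" using e by (auto simp: nbrs_def)
  qed (use v in \<open>auto simp: nbrs_def\<close>)
  moreover have "inj_on (\<lambda>u. {u, v}) (nbrs (edges G) S v)"
    by (auto simp: inj_on_def doubleton_eq_iff)
  ultimately show ?thesis by (simp add: degree_def induced_subgraph_def card_image)
qed

lemma two_components:
  assumes G: "simple_graph G" and S: "S \<subseteq> verts G" "S' \<subseteq> verts G" "S \<inter> S' = {}" "S \<noteq> {}" "S' \<noteq> {}"
    and sep: "\<And>u v. u \<in> S \<Longrightarrow> v \<in> S' \<Longrightarrow> {u, v} \<notin> edges G"
    and deg: "\<And>X v. X \<in> {S, S'} \<Longrightarrow> v \<in> X \<Longrightarrow> card X < 2 * card (nbrs (edges G) X v)"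
  shows "components (delete_verts G (verts G - (S \<union> S'))) = {induced_subgraph G S, induced_subgraph G S'}"
proof -
  let ?H = "delete_verts G (verts G - (S \<union> S'))"
  have cut: "verts G - (verts G - (S \<union> S')) = S \<union> S'" using S by auto
  have H: "?H = (S \<union> S', {e \<in> edges G. e \<subseteq> S \<union> S'})"
    using S by (auto simp: delete_verts_def induced_subgraph_def cut)
  have fin: "finite S" "finite S'" using G S by (auto simp: simple_graph_def intro: finite_subset)
  have sH: "simple_graph ?H" using G fin by (auto simp: H simple_graph_def)
  have nb: "nbrs (edges ?H) X v = nbrs (edges G) X v" if "X \<in> {S, S'}" "v \<in> X" for X v
    using that by (auto simp: H nbrs_def)
  have ind: "induced_subgraph ?H X = induced_subgraph G X" if "X \<in> {S, S'}" for X
    using that S by (auto simp: H induced_subgraph_def)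
  have r: "{w. reachable ?H v w} = X" if "X \<in> {S, S'}" "v \<in> X" for X v
  proof (rule reachable_within_half_degree[OF sH _ _ _ _ that(2)])
    show "X \<subseteq> verts ?H" "finite X" using that fin by (auto simp: H)
    show "{u, w} \<notin> edges ?H" if "u \<in> X" "w \<in> verts ?H - X" for u w
      using that \<open>X \<in> {S, S'}\<close> sep[of u w] sep[of w u] by (auto simp: H insert_commute)
    show "card X < 2 * card (nbrs (edges ?H) X u)" if "u \<in> X" for u
      using that \<open>X \<in> {S, S'}\<close> deg nb by metis
  qed
  have c: "induced_subgraph ?H {w. reachable ?H v w} = induced_subgraph G X" if "X \<in> {S, S'}" "v \<in> X" for X v
    using r[OF that] ind[OF that(1)] by simp
  have "components ?H = (\<lambda>v. induced_subgraph ?H {w. reachable ?H v w}) ` S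
      \<union> (\<lambda>v. induced_subgraph ?H {w. reachable ?H v w}) ` S'"
    by (simp add: components_def H image_Un)
  also have "(\<lambda>v. induced_subgraph ?H {w. reachable ?H v w}) ` S = {induced_subgraph G S}"
    using c[of S] S(4) by auto
  also have "(\<lambda>v. induced_subgraph ?H {w. reachable ?H v w}) ` S' = {induced_subgraph G S'}"
    using c[of S'] S(5) by auto
  finally show ?thesis by (simp only: insert_is_Un[symmetric])
qed

section \<open>The stability theorem\<close>

theorem theorem12:
  fixes G :: "'a ugraph" and n :: nat and \<alpha> \<beta> :: real
  assumes "0 < \<alpha>" and "\<alpha> < 1 / 10 ^ 5"
    and "0 \<le> \<beta>" and "\<beta> < 1 / 10 ^ 5"
    and "real n \<ge> inverse \<alpha> / 2"
    and "simple_graph G" and "graph_order G = n"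
    and "real (num_edges G) > (1 / 4 - \<beta>) * (real n)\<^sup>2"
  shows "real (circumference G) \<ge> (1 / 2 + \<alpha>) * real n \<or>
    (\<exists>M G1 G2. M \<subseteq> verts G \<and> real (card M) < 840 * (\<alpha> + 2 * \<beta>) * real n \<and>
       G1 \<noteq> G2 \<and> components (delete_verts G M) = {G1, G2} \<and>
       (1 / 2 - 840 * (\<alpha> + 2 * \<beta>)) * real n < real (graph_order G1) \<and>
       graph_order G1 \<le> graph_order G2 \<and>
       real (graph_order G2) < (1 / 2 + 20 * (\<alpha> + 2 * \<beta>)) * real n \<and>
       real (min_degree G1) \<ge> 3 * real n / 7 \<and>
       real (min_degree G2) \<ge> 3 * real n / 7)"
proof (cases "real (circumference G) \<ge> (1 / 2 + \<alpha>) * real n")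
  case False
  define \<gamma> where "\<gamma> = \<alpha> + 2 * \<beta>"
  have \<gamma>: "\<alpha> \<le> \<gamma>" "\<gamma> < 3 / 10 ^ 5" "0 < \<gamma>" using assms(1-4) by (simp_all add: \<gamma>_def)
  have half: "1 / 2 \<le> \<alpha> * real n"
  proof -
    have "\<alpha> * (inverse \<alpha> / 2) \<le> \<alpha> * real n" using assms(1,5) by (intro mult_left_mono) auto
    thus ?thesis using assms(1) by simp
  qed
  moreover have "\<alpha> * real n \<le> 1 / 10 ^ 5 * real n" using assms(2) by (intro mult_right_mono) auto
  ultimately have n: "50000 \<le> real n" by simp
  have fin: "finite (verts G)" and E: "\<forall>e\<in>edges G. card e = 2" "inside (edges G) (verts G) = edges G"
    using assms(6) by (auto simp: simple_graph_def inside_def)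
  interpret short_cycles "verts G" "edges G" "(1 / 2 + \<alpha>) * real n"
  proof
    have "1 / 2 * real n \<le> (1 / 2 + \<alpha>) * real n" using assms(1) by (intro mult_right_mono) auto
    thus "4 \<le> (1 / 2 + \<alpha>) * real n" using n by linarith
    show "real (length q) < (1 / 2 + \<alpha>) * real n" if "closes_up (edges G) q" "set q \<subseteq> verts G" for q
      using length_le_circumference[OF assms(6) that] False by linarith
  qed (rule fin, rule E(1))
  interpret near_extremal "verts G" "edges G" "(1 / 2 + \<alpha>) * real n" n \<alpha> \<gamma>
  proof
    show "card (verts G) = n" using assms(7) by (simp add: graph_order_def)
    have "\<alpha> * real n \<le> \<gamma> * real n" using \<gamma> by (intro mult_right_mono) auto
    thus "1 / 2 \<le> \<gamma> * real n" using half by simp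
    have "deficit (verts G) = (1 / 2 + \<alpha>) * (real n)\<^sup>2 / 2 - real (num_edges G)"
      using assms(7) E(2) by (simp add: deficit_def graph_order_def num_edges_def power2_eq_square)
    also have "\<dots> \<le> (1 / 2 + \<alpha>) * (real n)\<^sup>2 / 2 - (1 / 4 - \<beta>) * (real n)\<^sup>2" using assms(8) by simp
    also have "\<dots> = \<gamma> * (real n)\<^sup>2 / 2" by (simp add: \<gamma>_def field_simps)
    finally show "deficit (verts G) \<le> \<gamma> * (real n)\<^sup>2 / 2" .
  qed (use assms(1) \<gamma> in auto)
  \<comment> \<open>The two sides play symmetric roles; collecting their properties allows to order them by size.\<close>
  let ?near = "\<lambda>X. X \<subseteq> verts G \<and> (1 / 2 - 840 * \<gamma>) * real n < real (card X)
      \<and> real (card X) < (1 / 2 + 20 * \<gamma>) * real n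
      \<and> (\<forall>v\<in>X. 3 * real n / 7 \<le> real (card (nbrs (edges G) X v)))"
  obtain S S' where SS: "?near S" "?near S'" "S \<inter> S' = {}"
    "\<And>u v. u \<in> S \<Longrightarrow> v \<in> S' \<Longrightarrow> {u, v} \<notin> edges G"
    "real n - real (card S) - real (card S') < 840 * \<gamma> * real n" "card S \<le> card S'"
  proof -
    obtain S S' where *: "S \<subseteq> verts G" "S' \<subseteq> verts G" "S \<inter> S' = {}"
      "\<And>u v. u \<in> S \<Longrightarrow> v \<in> S' \<Longrightarrow> {u, v} \<notin> edges G"
      "\<And>X. X \<in> {S, S'} \<Longrightarrow> (1 / 2 - 840 * \<gamma>) * real n < real (card X)"
      "\<And>X. X \<in> {S, S'} \<Longrightarrow> real (card X) < (1 / 2 + 20 * \<gamma>) * real n"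
      "\<And>X v. X \<in> {S, S'} \<Longrightarrow> v \<in> X \<Longrightarrow> 3 * real n / 7 \<le> real (card (nbrs (edges G) X v))"
      "real n - real (card S) - real (card S') < 840 * \<gamma> * real n"
      using two_near_cliques by metis
    have near: "?near S" "?near S'" using * by auto
    show ?thesis
    proof (cases "card S \<le> card S'")
      case True
      show ?thesis by (rule that[OF near *(3,4,8) True])
    next
      case False
      show ?thesis
      proof (rule that[OF near(2,1)])
        show "S' \<inter> S = {}" using *(3) by blast
        show "{u, v} \<notin> edges G" if "u \<in> S'" "v \<in> S" for u v
          using *(4)[OF that(2,1)] by (simp add: insert_commute)
      qed (use *(8) False in auto)
    qed
  qed
  have g: "\<gamma> * real n \<le> 1 / 10000 * real n" using \<gamma>(2) by (intro mult_right_mono) auto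
  have ne: "X \<noteq> {}" if "?near X" for X
  proof
    assume "X = {}"
    hence "1 / 2 * real n - 840 * (\<gamma> * real n) < 0" using that by (simp add: left_diff_distrib)
    thus False using g n by linarith
  qed
  have dense: "card X < 2 * card (nbrs (edges G) X v)" if "?near X" "v \<in> X" for X v
  proof -
    have "real (card X) < 1 / 2 * real n + 20 * (\<gamma> * real n)" using that(1) by (simp add: distrib_right)
    moreover have "3 * real n / 7 \<le> real (card (nbrs (edges G) X v))" using that by blast
    ultimately have "real (card X) < 2 * real (card (nbrs (edges G) X v))" using g n by linarith
    thus ?thesis by linarith
  qed
  have order: "graph_order (induced_subgraph G X) = card X" if "?near X" for X
    using that by (simp add: graph_order_def induced_subgraph_def inf.absorb2)
  have mindeg: "3 * real n / 7 \<le> real (min_degree (induced_subgraph G X))" if "?near X" for X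
  proof -
    have vX: "verts (induced_subgraph G X) = X" using that by (auto simp: induced_subgraph_def)
    have "finite X" using that fin finite_subset by blast
    hence "min_degree (induced_subgraph G X) \<in> degree (induced_subgraph G X) ` X"
      unfolding min_degree_def vX using ne[OF that] by (intro Min_in) auto
    then obtain v where "v \<in> X" "min_degree (induced_subgraph G X) = card (nbrs (edges G) X v)"
      using degree_induced_subgraph[OF assms(6)] by auto
    thus ?thesis using that by auto
  qed
  let ?M = "verts G - (S \<union> S')"
  have finS: "finite S" "finite S'" using SS(1,2) fin finite_subset by blast+
  have "real (card ?M) = real n - real (card S) - real (card S')"
  proof -
    have "card (S \<union> S') = card S + card S'" using finS SS(3) by (simp add: card_Un_disjoint)
    moreover have "card (S \<union> S') \<le> card (verts G)" using SS(1,2) fin by (intro card_mono) auto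
    moreover have "card ?M = card (verts G) - card (S \<union> S')"
      using SS(1,2) finS by (intro card_Diff_subset) auto
    ultimately show ?thesis using assms(7) by (simp add: graph_order_def of_nat_diff)
  qed
  hence M: "real (card ?M) < 840 * (\<alpha> + 2 * \<beta>) * real n" using SS(5) by (simp add: \<gamma>_def)
  have comp: "components (delete_verts G ?M) = {induced_subgraph G S, induced_subgraph G S'}"
    using SS ne dense by (intro two_components[OF assms(6)]) auto
  have "verts (induced_subgraph G S) \<noteq> verts (induced_subgraph G S')"
    using SS(1,2,3) ne[OF SS(1)] by (auto simp: induced_subgraph_def)
  hence "induced_subgraph G S \<noteq> induced_subgraph G S'" by metis
  thus ?thesis
    using M comp SS(1,2,6) order[OF SS(1)] order[OF SS(2)] mindeg[OF SS(1)] mindeg[OF SS(2)]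
    unfolding \<gamma>_def by (intro disjI2 exI[of _ ?M] exI[of _ "induced_subgraph G S"] exI[of _ "induced_subgraph G S'"]) auto
qed simp

end
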